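(* Let $\mathcal B$ be a chordal building set on a finite set $S\subset\mathbb N$ with $|S|=2k$, $k\ge2$, such that no connected component of $\mathcal B$ has odd cardinality. Then the number of spheres in the wedge of $(k-2)$-dimensional spheres to which $\Delta(\mathcal P_{\mathcal B})$ is homotopy equivalent (equivalently, $\dim_{\mathbb Q}\widetilde H_{k-2}(\Delta(\mathcal P_{\mathcal B});\mathbb Q)$) equals the number of alternating $\mathcal B$-permutations.
   Context: A building set on a finite set $S\subset\mathbb N$ is a collection $\mathcal B$ of nonempty subsets of $S$ containing every singleton $\{i\}$, $i\in S$, such that $I,J\in\mathcal B$ and $I\cap J\neq\emptyset$ imply $I\cup J\in\mathcal B$. Its connected components are the inclusion-maximal elements of $\mathcal B$. For $I\subseteq S$, $\mathcal B|_I=\{J\in\mathcal B:J\subseteq I\}$. $\mathcal B$ is chordal if for every $I=\{i_1<\dots<i_r\}\in\mathcal B$ and every $1<s<r$, $\{i_s,\dots,i_r\}\in\mathcal B$. $\widehat{\mathcal P}_{\mathcal B}=\{I\subseteq S:\ \mathcal B|_I\text{ has no connected component of odd cardinality}\}$, ordered by inclusion, and $\mathcal P_{\mathcal B}=\widehat{\mathcal P}_{\mathcal B}\setminus\{\emptyset,S\}$. $\Delta(P)$ denotes the order complex (simplicial complex of finite nonempty chains) of a poset $P$; under these hypotheses $\Delta(\mathcal P_{\mathcal B})$ is homotopy equivalent to a wedge of $(k-2)$-spheres. For a building set $\mathcal B$ on $S$ with $|S|=m$, a $\mathcal B$-permutation is a sequence $(x_1x_2\cdots x_m)$ listing each element of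 $S$ exactly once such that for each $1\le i\le m$, $x_i$ and $\max\{x_1,\dots,x_i\}$ lie in the same connected component of $\mathcal B|_{\{x_1,\dots,x_i\}}$. It is alternating if $x_1>x_2<x_3>x_4<\cdots$. *)

theory Defs
  imports Complex_Main "HOL-Library.Function_Algebras"
begin

definition building_set :: "nat set \<Rightarrow> nat set set \<Rightarrow> bool" where
  "building_set S B \<longleftrightarrow> finite S \<and> (\<forall>I\<in>B. I \<noteq> {} \<and> I \<subseteq> S) \<and>
     (\<forall>i\<in>S. {i} \<in> B) \<and>
     (\<forall>I\<in>B. \<forall>J\<in>B. I \<inter> J \<noteq> {} \<longrightarrow> I \<union> J \<in> B)"

definition components :: "nat set set \<Rightarrow> nat set set" where
  "components B = {I \<in> B. \<forall>J\<in>B. I \<subseteq> J \<longrightarrow> J = I}"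

definition restr :: "nat set set \<Rightarrow> nat set \<Rightarrow> nat set set" where
  "restr B I = {J \<in> B. J \<subseteq> I}"

definition chordal :: "nat set set \<Rightarrow> bool" where
  "chordal B \<longleftrightarrow> (\<forall>I\<in>B. \<forall>j\<in>I. j \<noteq> Min I \<and> j \<noteq> Max I \<longrightarrow> {x\<in>I. j \<le> x} \<in> B)"

definition Phat :: "nat set \<Rightarrow> nat set set \<Rightarrow> nat set set" where
  "Phat S B = {I. I \<subseteq> S \<and> (\<forall>C\<in>components (restr B I). even (card C))}"

definition Pposet :: "nat set \<Rightarrow> nat set set \<Rightarrow> nat set set" where
  "Pposet S B = Phat S B - {{}, S}"

definition B_permutation :: "nat set \<Rightarrow> nat set set \<Rightarrow> nat list \<Rightarrow> bool" where
  "B_permutation S B xs \<longleftrightarrow> distinct xs \<and> set xs = S \<and>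
     (\<forall>i<length xs. \<exists>C\<in>components (restr B (set (take (Suc i) xs))).
         xs ! i \<in> C \<and> Max (set (take (Suc i) xs)) \<in> C)"

definition alternating :: "nat list \<Rightarrow> bool" where
  "alternating xs \<longleftrightarrow> (\<forall>i. Suc i < length xs \<longrightarrow>
     (even i \<longrightarrow> xs ! i > xs ! Suc i) \<and> (odd i \<longrightarrow> xs ! i < xs ! Suc i))"

text \<open>Simplices of the order complex of a family P of sets ordered by inclusion,
  with n vertices, listed as strictly increasing chains. n = 0 gives the empty
  simplex, so the chain complex below is the augmented one (reduced homology).\<close>
definition ord_simplices :: "'a set set \<Rightarrow> nat \<Rightarrow> 'a set list set" where
  "ord_simplices P n = {xs. sorted_wrt (\<subset>) xs \<and> set xs \<subseteq> P \<and> length xs = n}"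

definition chains :: "'a set set \<Rightarrow> nat \<Rightarrow> ('a set list \<Rightarrow> rat) set" where
  "chains P n = {f. \<forall>xs. f xs \<noteq> 0 \<longrightarrow> xs \<in> ord_simplices P n}"

definition del_nth :: "nat \<Rightarrow> 'b list \<Rightarrow> 'b list" where
  "del_nth i xs = take i xs @ drop (Suc i) xs"

definition bdry :: "'a set set \<Rightarrow> nat \<Rightarrow> ('a set list \<Rightarrow> rat) \<Rightarrow> ('a set list \<Rightarrow> rat)" where
  "bdry P n f = (\<lambda>ys. \<Sum>xs\<in>ord_simplices P n. \<Sum>i<n.
      if del_nth i xs = ys then (-1) ^ i * f xs else 0)"

abbreviation qdim :: "('a set list \<Rightarrow> rat) set \<Rightarrow> nat" where
  "qdim \<equiv> vector_space.dim (\<lambda>(c::rat) f. (\<lambda>x. c * f x))"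

definition reduced_betti :: "'a set set \<Rightarrow> nat \<Rightarrow> nat" where
  "reduced_betti P d =
     qdim {f \<in> chains P (d + 1). bdry P (d + 1) f = (\<lambda>_. 0)}
     - qdim (bdry P (d + 2) ` chains P (d + 2))"

end

theory Submission
  imports Defs "HOL-Library.Product_Lexorder" "HOL-Library.List_Lexorder"
begin

text \<open>
  All maximal chains of the poset have one element of each cardinality 2, 4, \<dots>, 2k - 2, so the
  Betti number is the dimension of the space of top-dimensional cycles, and for a shellable complex
  that dimension is the number of facets whose ridges all lie in earlier facets.

  A step from \<open>I\<close> to \<open>K = I \<union> {a < b}\<close> is labelled by \<open>(p, b, a)\<close>, where \<open>p\<close> is the largest element of
  the component of \<open>K\<close> containing \<open>b\<close> (parity puts \<open>a\<close> in the same component). Maximal chains are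
  ordered lexicographically by their labels, larger labels first. By chordality the first chain of
  an interval from \<open>I\<close> to \<open>J\<close> begins by adding the two largest missing elements of the component
  of \<open>J\<close> with the largest maximum among those not contained in \<open>I\<close>. Two consecutive steps
  \<open>(p, b, a)\<close>, \<open>(p', b', a')\<close> are in this first position iff \<open>p' < p\<close>, or \<open>p' = p\<close> and \<open>b' < a\<close>.
  A chain in which this never happens has weakly increasing \<open>p\<close>, so that \<open>p\<close> is the maximum of the
  whole set at each step, and \<open>a < b'\<close> throughout: reading off \<open>b a b' a' \<dots>\<close> gives exactly the
  alternating permutations.
\<close>

section \<open>Top cycles of shellable order complexes\<close>

lemma length_del_nth: "i < length xs \<Longrightarrow> length (del_nth i xs) = length xs - 1"
  by (simp add: del_nth_def)

lemma nth_del_nth: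
  "i < length xs \<Longrightarrow> p < length xs - 1 \<Longrightarrow> del_nth i xs ! p = (if p < i then xs ! p else xs ! Suc p)"
  by (auto simp: del_nth_def nth_append min_def)

text \<open>The simplicial identity for faces. Writing the larger index as \<open>Suc i\<close>
  shows the shift by one without subtraction.\<close>

lemma del_nth_del_nth:
  assumes "j \<le> i" "Suc i < length xs"
  shows "del_nth j (del_nth (Suc i) xs) = del_nth i (del_nth j xs)"
  using assms by (intro nth_equalityI) (auto simp: length_del_nth nth_del_nth)

lemma set_del_nth:
  assumes "distinct xs" "i < length xs"
  shows "set (del_nth i xs) = set xs - {xs ! i}"
proof -
  have xs: "xs = take i xs @ xs ! i # drop (Suc i) xs"
    using assms(2) by (simp add: id_take_nth_drop)
  have "distinct (take i xs @ xs ! i # drop (Suc i) xs)"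
    using xs assms(1) by metis
  moreover have "set xs = set (take i xs @ xs ! i # drop (Suc i) xs)"
    using xs by metis
  ultimately show ?thesis
    by (auto simp: del_nth_def)
qed

lemma finite_ord_simplices: "finite P \<Longrightarrow> finite (ord_simplices P n)"
  by (rule finite_subset[OF _ finite_lists_length_eq[of P n]]) (auto simp: ord_simplices_def)

lemma ord_simplicesD:
  assumes "xs \<in> ord_simplices P n"
  shows "length xs = n" "distinct xs" "set xs \<subseteq> P" "sorted_wrt (\<subset>) xs"
proof -
  show "length xs = n" "set xs \<subseteq> P" and s: "sorted_wrt (\<subset>) xs"
    using assms by (auto simp: ord_simplices_def)
  show "distinct xs"
    unfolding distinct_conv_nth
    by (metis linorder_neqE_nat psubset_eq s sorted_wrt_iff_nth_less)
qed

lemma del_nth_ord_simplices: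
  assumes "xs \<in> ord_simplices P (Suc n)" "i \<le> n"
  shows "del_nth i xs \<in> ord_simplices P n"
proof -
  note D = ord_simplicesD[OF assms(1)]
  have "set (del_nth i xs) \<subseteq> P"
    using D assms(2) by (simp add: set_del_nth subset_iff)
  moreover have "sorted_wrt (\<subset>) (del_nth i xs)"
    using D assms(2) by (auto simp: sorted_wrt_iff_nth_less length_del_nth nth_del_nth)
  ultimately show ?thesis
    using D assms(2) by (simp add: ord_simplices_def length_del_nth)
qed

section \<open>The boundary operator\<close>

lemma bdry_lincomb:
  "bdry P n (\<lambda>x. \<Sum>i\<in>A. c i * g i x) = (\<lambda>y. \<Sum>i\<in>A. c i * bdry P n (g i) y)"
proof
  fix y
  have "bdry P n (\<lambda>x. \<Sum>i\<in>A. c i * g i x) y =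
    (\<Sum>xs\<in>ord_simplices P n. \<Sum>j<n. \<Sum>i\<in>A. c i * (if del_nth j xs = y then (-1) ^ j * g i xs else 0))"
    unfolding bdry_def by (intro sum.cong refl) (auto simp: sum_distrib_left mult_ac)
  also have "\<dots> = (\<Sum>xs\<in>ord_simplices P n. \<Sum>i\<in>A. \<Sum>j<n. c i * (if del_nth j xs = y then (-1) ^ j * g i xs else 0))"
    by (rule sum.cong[OF refl], rule sum.swap)
  also have "\<dots> = (\<Sum>i\<in>A. \<Sum>xs\<in>ord_simplices P n. \<Sum>j<n. c i * (if del_nth j xs = y then (-1) ^ j * g i xs else 0))"
    by (rule sum.swap)
  also have "\<dots> = (\<Sum>i\<in>A. c i * bdry P n (g i) y)"
    by (simp add: bdry_def sum_distrib_left)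
  finally show "bdry P n (\<lambda>x. \<Sum>i\<in>A. c i * g i x) y = (\<Sum>i\<in>A. c i * bdry P n (g i) y)" .
qed

lemma bdry_diff_scale:
  "bdry P n (\<lambda>x. f x - c * g x) = (\<lambda>y. bdry P n f y - c * bdry P n g y)"
  \<comment> \<open>A two-term difference is a linear combination indexed by the Booleans.\<close>
  using bdry_lincomb[of P n "\<lambda>b. if b then 1 else - c" "\<lambda>b. if b then f else g" UNIV]
  by (simp add: UNIV_bool add.commute)

definition basis_chain :: "'b \<Rightarrow> 'b \<Rightarrow> rat" where
  "basis_chain x = (\<lambda>y. if y = x then 1 else 0)"

lemma bdry_basis_chain:
  assumes "finite P" "x \<in> ord_simplices P n"
  shows "bdry P n (basis_chain x) = (\<lambda>y. \<Sum>i<n. (-1) ^ i * basis_chain (del_nth i x) y)"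
proof
  fix y
  have "bdry P n (basis_chain x) y =
    (\<Sum>z\<in>ord_simplices P n. if z = x then (\<Sum>i<n. (-1) ^ i * basis_chain (del_nth i x) y) else 0)"
    unfolding bdry_def by (intro sum.cong refl) (auto simp: basis_chain_def intro!: sum.cong sum.neutral)
  also have "\<dots> = (\<Sum>i<n. (-1) ^ i * basis_chain (del_nth i x) y)"
    using assms by (simp add: finite_ord_simplices)
  finally show "bdry P n (basis_chain x) y = (\<Sum>i<n. (-1) ^ i * basis_chain (del_nth i x) y)" .
qed

lemma bdry_basis_chain_nonzero:
  assumes "finite P" "x \<in> ord_simplices P n" "bdry P n (basis_chain x) y \<noteq> 0"
  shows "\<exists>i<n. y = del_nth i x"
  using assms(3) unfolding bdry_basis_chain[OF assms(1,2)]
  by (elim sum.not_neutral_contains_not_neutral) (auto simp: basis_chain_def split: if_splits)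

text \<open>Terms with \<open>j < i\<close> cancel those with \<open>i <= j\<close> by the
  simplicial identity. Basis chains suffice later, because only boundaries of single facets are
  subtracted.\<close>

lemma bdry_bdry_basis_chain:
  assumes "finite P" "x \<in> ord_simplices P (Suc n)"
  shows "bdry P n (bdry P (Suc n) (basis_chain x)) = (\<lambda>_. 0)"
proof
  fix z
  define h :: "nat \<times> nat \<Rightarrow> rat" where
    "h = (\<lambda>(i, j). (-1) ^ (i + j) * basis_chain (del_nth j (del_nth i x)) z)"
  define L where "L = {p \<in> {..<Suc n} \<times> {..<n}. snd p < fst p}"
  define U where "U = {p \<in> {..<Suc n} \<times> {..<n}. fst p \<le> snd p}"
  have len: "length x = Suc n"
    using ord_simplicesD(1)[OF assms(2)] .
  have "bdry P n (bdry P (Suc n) (basis_chain x)) z =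
     (\<Sum>i<Suc n. (-1) ^ i * bdry P n (basis_chain (del_nth i x)) z)"
    by (simp add: bdry_basis_chain[OF assms] bdry_lincomb del: sum.lessThan_Suc)
  also have "\<dots> = (\<Sum>i<Suc n. \<Sum>j<n. h (i, j))"
    using assms
    by (intro sum.cong refl)
       (simp add: bdry_basis_chain del_nth_ord_simplices h_def power_add sum_distrib_left mult_ac)
  also have "\<dots> = sum h ({..<Suc n} \<times> {..<n})"
    by (simp add: sum.cartesian_product del: sum.lessThan_Suc)
  also have "{..<Suc n} \<times> {..<n} = L \<union> U"
    by (auto simp: L_def U_def)
  also have "sum h (L \<union> U) = sum h L + sum h U"
    by (rule sum.union_disjoint) (auto simp: L_def U_def)
  also have "sum h L = sum (\<lambda>p. - h p) U"
  \<comment> \<open>The pair \<open>(i, j)\<close> with \<open>j < i\<close> is matched with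
    \<open>(j, i - 1)\<close>: the same double face, with exponent smaller by one and hence the
    opposite sign.\<close>
  proof (rule sum.reindex_bij_witness[where i = "\<lambda>(i, j). (Suc j, i)" and j = "\<lambda>(i, j). (j, i - 1)"])
    fix p assume "p \<in> L"
    then obtain i j where p: "p = (Suc i, j)" "j \<le> i" "i < n"
      by (cases p; cases "fst p") (auto simp: L_def)
    then show "- h (case p of (i, j) \<Rightarrow> (j, i - 1)) = h p"
      using del_nth_del_nth[of j i x] len by (simp add: h_def add.commute)
  qed (auto simp: L_def U_def)
  also have "sum (\<lambda>p. - h p) U + sum h U = 0"
    by (simp add: sum_negf)
  finally show "bdry P n (bdry P (Suc n) (basis_chain x)) z = 0" .
qed

text \<open>If \<open>f\<close> vanishes on every other simplex with this face, nothing can cancel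
  there, so a cycle must vanish at \<open>x\<close> too. Used for ridges and for faces of
  codimension two.\<close>

lemma bdry_at_isolated_face:
  assumes "finite P" "x \<in> ord_simplices P n" "i < n"
    and "\<And>y j. y \<in> ord_simplices P n \<Longrightarrow> j < n \<Longrightarrow> del_nth j y = del_nth i x \<Longrightarrow> y \<noteq> x \<Longrightarrow> f y = 0"
  shows "bdry P n f (del_nth i x) = (-1) ^ i * f x"
proof -
  note D = ord_simplicesD[OF assms(2)]
  \<comment> \<open>Vertices are distinct, so a face of \<open>x\<close> determines the deleted
    position.\<close>
  have uniq: "j = i" if "j < n" "del_nth j x = del_nth i x" for j
  proof (rule ccontr)
    assume "j \<noteq> i"
    then have "x ! i \<in> set (del_nth j x)"
      using D that(1) assms(3) by (simp add: set_del_nth nth_eq_iff_index_eq)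
    then show False
      using D that assms(3) by (simp add: set_del_nth)
  qed
  have "bdry P n f (del_nth i x) =
     (\<Sum>y\<in>ord_simplices P n. if y = x then (\<Sum>j<n. if j = i then (-1) ^ i * f x else 0) else 0)"
    unfolding bdry_def
  proof (intro sum.cong refl)
    fix y assume y: "y \<in> ord_simplices P n"
    show "(\<Sum>j<n. if del_nth j y = del_nth i x then (-1) ^ j * f y else 0) =
       (if y = x then (\<Sum>j<n. if j = i then (-1) ^ i * f x else 0) else 0)"
    proof (cases "y = x")
      case True
      have "(\<Sum>j<n. if del_nth j x = del_nth i x then (-1) ^ j * f x else 0) =
         (\<Sum>j<n. if j = i then (-1) ^ i * f x else 0)"
        using uniq by (intro sum.cong refl) auto
      then show ?thesis
        unfolding True if_P[OF refl] .
    next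
      case False
      then show ?thesis
        using assms(4)[OF y] by (auto intro!: sum.neutral)
    qed
  qed
  then show ?thesis
    using assms by (simp add: finite_ord_simplices)
qed

section \<open>Shellings and their top-dimensional cycles\<close>

interpretation Q: vector_space "\<lambda>(c::rat) f. (\<lambda>x. c * f x)"
  by unfold_locales (auto simp: fun_eq_iff algebra_simps)

text \<open>
  \<open>pos\<close> is the position of a facet in the shelling and \<open>asc F\<close> is the complement of the restriction
  face of \<open>F\<close>, as a set of indices into \<open>F\<close>. Only faces of codimension one and two are constrained,
  as nothing else affects the top-dimensional cycles.
\<close>

locale shelling =
  fixes P :: "'a set set" and m :: nat
    and pos :: "'a set list \<Rightarrow> nat" and asc :: "'a set list \<Rightarrow> nat set"
  assumes finite_P: "finite P"
    and graded: "\<And>F G p q. F \<in> ord_simplices P (Suc m) \<Longrightarrow> G \<in> ord_simplices P (Suc m) \<Longrightarrow>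
       p \<le> m \<Longrightarrow> q \<le> m \<Longrightarrow> F ! p = G ! q \<Longrightarrow> p = q"
    and inj_pos: "inj_on pos (ord_simplices P (Suc m))"
    and asc_le: "\<And>F i. F \<in> ord_simplices P (Suc m) \<Longrightarrow> i \<in> asc F \<Longrightarrow> i \<le> m"
    and first: "\<And>F G i j. F \<in> ord_simplices P (Suc m) \<Longrightarrow> G \<in> ord_simplices P (Suc m) \<Longrightarrow>
       i \<in> asc F \<Longrightarrow> j \<in> asc F \<Longrightarrow> (\<And>p. p \<le> m \<Longrightarrow> p \<noteq> i \<Longrightarrow> p \<noteq> j \<Longrightarrow> G ! p = F ! p) \<Longrightarrow>
       G \<noteq> F \<Longrightarrow> pos F < pos G"
    and earlier: "\<And>F i. F \<in> ord_simplices P (Suc m) \<Longrightarrow> i \<le> m \<Longrightarrow> i \<notin> asc F \<Longrightarrow>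
       \<exists>G\<in>ord_simplices P (Suc m). pos G < pos F \<and> (\<forall>p\<le>m. p \<noteq> i \<longrightarrow> G ! p = F ! p)"
begin

abbreviation facets where "facets \<equiv> ord_simplices P (Suc m)"

text \<open>The axiom \<open>first\<close> in terms of faces: by \<open>graded\<close> a common
  vertex has the same position in both facets, so containing the rest of \<open>F\<close> means
  agreeing with \<open>F\<close> off \<open>i\<close> and \<open>j\<close>.\<close>

lemma first_le:
  assumes "F \<in> facets" "G \<in> facets" "i \<in> asc F" "j \<in> asc F" "set F - {F ! i, F ! j} \<subseteq> set G" "pos G \<le> pos F"
  shows "G = F"
proof (rule ccontr)
  assume "G \<noteq> F"
  have "G ! p = F ! p" if p: "p \<le> m" "p \<noteq> i" "p \<noteq> j" for p
  proof -
    have "F ! p \<in> set F - {F ! i, F ! j}"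
      using p ord_simplicesD[OF assms(1)] asc_le[OF assms(1,3)] asc_le[OF assms(1,4)]
      by (simp add: nth_eq_iff_index_eq)
    then obtain q where q: "q \<le> m" "F ! p = G ! q"
      using assms(5) ord_simplicesD(1)[OF assms(2)] by (metis in_set_conv_nth less_Suc_eq_le subsetD)
    then show ?thesis
      using graded[OF assms(1,2) p(1) q(1)] by simp
  qed
  then show False
    using first[OF assms(1-4)] \<open>G \<noteq> F\<close> assms(6) by fastforce
qed

lemma face_earlier:
  assumes "F \<in> facets" "i \<le> m" "i \<notin> asc F"
  shows "\<exists>G\<in>facets. pos G < pos F \<and> (\<exists>j\<le>m. del_nth i F = del_nth j G)"
proof -
  obtain G where G: "G \<in> facets" "pos G < pos F" "\<And>p. p \<le> m \<Longrightarrow> p \<noteq> i \<Longrightarrow> G ! p = F ! p"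
    using earlier[OF assms] by blast
  have "del_nth i F = del_nth i G"
    using ord_simplicesD(1)[OF assms(1)] ord_simplicesD(1)[OF G(1)] assms(2) G(3)
    by (intro nth_equalityI) (auto simp: length_del_nth nth_del_nth)
  then show ?thesis
    using G assms(2) by blast
qed

text \<open>
  When a facet \<open>F\<close> with \<open>v \<in> asc F\<close> is added, a multiple of the boundary of \<open>F\<close> clears the coefficient at
  \<open>F - v\<close>. The coefficient at any other new ridge \<open>F - u\<close> then vanishes too, because \<open>F - u - v\<close> lies
  in no other ridge in use.
\<close>

lemma cycle_bounds_earlier:
  assumes "\<And>x. w x \<noteq> 0 \<Longrightarrow> \<exists>G\<in>facets. pos G < t \<and> (\<exists>i\<le>m. x = del_nth i G)"
    and "bdry P m w = (\<lambda>_. 0)"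
  shows "\<exists>c. (\<forall>x. c x \<noteq> 0 \<longrightarrow> x \<in> facets \<and> pos x < t) \<and> bdry P (Suc m) c = w"
  using assms
proof (induction t arbitrary: w)
  case 0
  then have "w = (\<lambda>_. 0)" by auto
  then show ?case
    by (intro exI[of _ "\<lambda>_. 0"]) (auto simp: bdry_def fun_eq_iff intro!: sum.neutral)
next
  case (Suc t)
  \<comment> \<open>Position \<open>t\<close> may be vacant, its facet may bring no new ridge, or it
    may have an ascent \<open>v\<close>.\<close>
  consider "\<not> (\<exists>F\<in>facets. pos F = t)" | F where "F \<in> facets" "pos F = t" "asc F = {}"
    | F v where "F \<in> facets" "pos F = t" "v \<in> asc F"
    by blast
  then show ?case
  proof cases
    case 1
    then have "\<exists>G\<in>facets. pos G < t \<and> (\<exists>i\<le>m. x = del_nth i G)" if "w x \<noteq> 0" for x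
      using Suc.prems(1)[OF that] by (metis less_Suc_eq)
    then show ?thesis
      using Suc.IH[OF _ Suc.prems(2)] by (meson less_Suc_eq)
  next
    case (2 F)
    have "\<exists>G\<in>facets. pos G < t \<and> (\<exists>i\<le>m. x = del_nth i G)" if x: "w x \<noteq> 0" for x
    proof -
      obtain G i where G: "G \<in> facets" "pos G < Suc t" "i \<le> m" "x = del_nth i G"
        using Suc.prems(1)[OF x] by blast
      show ?thesis
      proof (cases "pos G = t")
        case True
        then have "G = F"
          using 2 G inj_pos by (auto dest: inj_onD)
        then show ?thesis
          using face_earlier[OF 2(1) G(3)] 2 G(4) by auto
      next
        case False
        then have "pos G < t"
          using G(2) by simp
        then show ?thesis
          using G by blast
      qed
    qed
    then show ?thesis
      using Suc.IH[OF _ Suc.prems(2)] by (meson less_Suc_eq)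
  next
    case (3 F v)
    note DF = ord_simplicesD[OF 3(1)]
    have vm: "v \<le> m"
      using asc_le 3 by blast
    define e where "e = bdry P (Suc m) (basis_chain F)"
    \<comment> \<open>\<open>(-1) ^ v\<close> is its own inverse, so subtracting \<open>a\<close>
      times \<open>e\<close> leaves coefficient 0 at \<open>F - v\<close>.\<close>
    define a where "a = (-1) ^ v * w (del_nth v F)"
    define w' where "w' = (\<lambda>x. w x - a * e x)"
    have e: "e x \<noteq> 0 \<Longrightarrow> \<exists>i\<le>m. x = del_nth i F" for x
      unfolding e_def using bdry_basis_chain_nonzero[OF finite_P 3(1)] by (auto simp: less_Suc_eq_le)
    have "e (del_nth v F) = (-1) ^ v"
      unfolding e_def using bdry_at_isolated_face[OF finite_P 3(1), of v "basis_chain F"] vm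
      by (simp add: basis_chain_def)
    then have w'v: "w' (del_nth v F) = 0"
      by (simp add: w'_def a_def flip: power_add)
    have cyc: "bdry P m w' = (\<lambda>_. 0)"
      unfolding w'_def bdry_diff_scale Suc.prems(2) e_def bdry_bdry_basis_chain[OF finite_P 3(1)] by simp
    have w'G: "\<exists>G\<in>facets. pos G < Suc t \<and> (\<exists>i\<le>m. x = del_nth i G)" if "w' x \<noteq> 0" for x
    proof (cases "w x = 0")
      case True
      then have "e x \<noteq> 0"
        using that by (auto simp: w'_def)
      then show ?thesis
        using e[of x] 3 by auto
    qed (use Suc.prems(1) in auto)
    have "\<exists>G\<in>facets. pos G < t \<and> (\<exists>i\<le>m. x = del_nth i G)" if x: "w' x \<noteq> 0" for x
    proof (rule ccontr)
      assume no: "\<not> ?thesis"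
      obtain G u where G: "G \<in> facets" "pos G < Suc t" "u \<le> m" "x = del_nth u G"
        using w'G[OF x] by blast
      have "pos G = t"
        using no G by (metis less_Suc_eq)
      then have "G = F"
        using 3 G inj_pos by (auto dest: inj_onD)
      then have xu: "x = del_nth u F"
        using G by simp
      have u: "u \<in> asc F"
        using face_earlier[OF 3(1) G(3)] no xu 3 by auto
      have uv: "u \<noteq> v"
        using x w'v xu by auto
      have xO: "x \<in> ord_simplices P m"
        using del_nth_ord_simplices[OF 3(1) G(3)] xu by simp
      note Dx = ord_simplicesD[OF xO]
      have setx: "set x = set F - {F ! u}"
        using set_del_nth[of F u] DF G(3) xu by simp
      moreover have "F ! v \<in> set F - {F ! u}"
        using uv vm G(3) DF by (simp add: nth_eq_iff_index_eq)
      ultimately obtain v' where v': "v' < m" "x ! v' = F ! v"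
        using Dx(1) by (metis in_set_conv_nth)
      have setz: "set (del_nth v' x) = set F - {F ! u, F ! v}"
        using set_del_nth[of x v'] Dx v' setx by auto
      have "bdry P m w' (del_nth v' x) = (-1) ^ v' * w' x"
      proof (rule bdry_at_isolated_face[OF finite_P xO v'(1)])
        fix y j
        assume y: "y \<in> ord_simplices P m" "j < m" "del_nth j y = del_nth v' x" "y \<noteq> x"
        show "w' y = 0"
        proof (rule ccontr)
          assume y0: "w' y \<noteq> 0"
          obtain H i where H: "H \<in> facets" "pos H < Suc t" "i \<le> m" "y = del_nth i H"
            using w'G[OF y0] by blast
          have sub: "set F - {F ! u, F ! v} \<subseteq> set y"
            using setz y set_del_nth[of y j] ord_simplicesD[OF y(1)] by auto
          have sety: "set y = set H - {H ! i}"
            using set_del_nth[of H i] H ord_simplicesD[OF H(1)] by auto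
          \<comment> \<open>\<open>H\<close> contains \<open>F - u - v\<close> and comes no later
            than \<open>F\<close>, so \<open>first_le\<close> identifies the two. Then
            \<open>y\<close> is a third ridge of \<open>F\<close>, which cannot contain
            \<open>F - u - v\<close>.\<close>
          have HF: "H = F"
            using first_le[OF 3(1) H(1) u 3(3)] sub sety H(2) 3(2) by auto
          have "i \<noteq> u" "i \<noteq> v"
            using y(4) xu H(4) HF y0 w'v by auto
          then have "F ! i \<in> set F - {F ! u, F ! v}"
            using H(3) G(3) vm DF by (simp add: nth_eq_iff_index_eq)
          then show False
            using sub sety HF by auto
        qed
      qed
      then show False
        using x cyc by simp
    qed
    then obtain c where c: "\<And>x. c x \<noteq> 0 \<Longrightarrow> x \<in> facets \<and> pos x < t" "bdry P (Suc m) c = w'"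
      using Suc.IH[OF _ cyc] by blast
    have "bdry P (Suc m) (\<lambda>x. c x - (- a) * basis_chain F x) = w"
      unfolding bdry_diff_scale c(2) e_def[symmetric] by (simp add: w'_def)
    moreover have "x \<in> facets \<and> pos x < Suc t" if "c x - (- a) * basis_chain F x \<noteq> 0" for x
    proof (cases "x = F")
      case False
      then have "c x \<noteq> 0"
        using that by (simp add: basis_chain_def)
      then show ?thesis
        using c(1) by fastforce
    qed (use 3 in simp)
    ultimately show ?thesis
      by (intro exI[of _ "\<lambda>x. c x - (- a) * basis_chain F x"]) blast
  qed
qed

text \<open>Every ridge of \<open>F\<close> lies in an earlier facet, so the boundary of
  \<open>F\<close> is also the boundary of a chain \<open>c\<close> on earlier facets, and
  \<open>F - c\<close> is a cycle with last term \<open>F\<close>.\<close>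

lemma cycle_of_homology_facet:
  assumes "F \<in> facets" "asc F = {}"
  shows "\<exists>z. (\<forall>x. z x \<noteq> 0 \<longrightarrow> x \<in> facets \<and> (x = F \<or> pos x < pos F)) \<and>
    bdry P (Suc m) z = (\<lambda>_. 0) \<and> z F = 1"
proof -
  have "\<exists>G\<in>facets. pos G < pos F \<and> (\<exists>i\<le>m. x = del_nth i G)"
    if x: "bdry P (Suc m) (basis_chain F) x \<noteq> 0" for x
  proof -
    obtain i where "i \<le> m" "x = del_nth i F"
      using bdry_basis_chain_nonzero[OF finite_P assms(1) x] by (auto simp: less_Suc_eq_le)
    then show ?thesis
      using face_earlier[OF assms(1)] assms(2) by blast
  qed
  then obtain c where c: "\<And>x. c x \<noteq> 0 \<Longrightarrow> x \<in> facets \<and> pos x < pos F"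
      "bdry P (Suc m) c = bdry P (Suc m) (basis_chain F)"
    using cycle_bounds_earlier[OF _ bdry_bdry_basis_chain[OF finite_P assms(1)]] by blast
  have "c F = 0"
    using c(1) by blast
  moreover have "bdry P (Suc m) (\<lambda>x. basis_chain F x - 1 * c x) = (\<lambda>_. 0)"
    unfolding bdry_diff_scale c(2) by simp
  moreover have "x \<in> facets \<and> (x = F \<or> pos x < pos F)" if "basis_chain F x - 1 * c x \<noteq> 0" for x
    using that c(1)[of x] assms(1) by (cases "x = F") (auto simp: basis_chain_def)
  ultimately show ?thesis
    by (intro exI[of _ "\<lambda>x. basis_chain F x - 1 * c x"]) (auto simp: basis_chain_def)
qed

text \<open>The cycles of facets with empty \<open>asc\<close> are independent because their last
  facets are distinct. They span because the last facet of a nonzero cycle is one of these, and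
  subtracting a multiple of its cycle moves the support strictly earlier.\<close>

theorem qdim_top_cycles:
  "qdim {f \<in> chains P (Suc m). bdry P (Suc m) f = (\<lambda>_. 0)} = card {F \<in> facets. asc F = {}}"
proof -
  define Z where "Z = {f \<in> chains P (Suc m). bdry P (Suc m) f = (\<lambda>_. 0)}"
  define H where "H = {F \<in> facets. asc F = {}}"
  define z where "z = (\<lambda>F. SOME z. (\<forall>x. z x \<noteq> 0 \<longrightarrow> x \<in> facets \<and> (x = F \<or> pos x < pos F)) \<and>
    bdry P (Suc m) z = (\<lambda>_. 0) \<and> z F = 1)"
  have z: "\<And>F x. F \<in> H \<Longrightarrow> z F x \<noteq> 0 \<Longrightarrow> x \<in> facets \<and> (x = F \<or> pos x < pos F)"
      "\<And>F. F \<in> H \<Longrightarrow> bdry P (Suc m) (z F) = (\<lambda>_. 0)" "\<And>F. F \<in> H \<Longrightarrow> z F F = 1"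
    using someI_ex[OF cycle_of_homology_facet] unfolding H_def z_def by blast+
  have finH: "finite H"
    using finite_ord_simplices[OF finite_P] by (simp add: H_def)
  have posH: "F = G" if "F \<in> H" "G \<in> H" "pos F = pos G" for F G
    using that inj_pos by (auto simp: H_def dest: inj_onD)
  have inj: "inj_on z H"
  proof (rule inj_onI)
    fix F G assume FG: "F \<in> H" "G \<in> H" "z F = z G"
    have "F = G \<or> pos F < pos G" "G = F \<or> pos G < pos F"
      using z(1)[OF FG(2), of F] z(1)[OF FG(1), of G] z(3)[OF FG(1)] z(3)[OF FG(2)] FG(3) by auto
    then show "F = G" by auto
  qed
  have zZ: "z ` H \<subseteq> Z"
    using z(1,2) by (fastforce simp: Z_def chains_def)
  have indep: "\<not> Q.dependent (z ` H)"
  proof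
    assume dep: "Q.dependent (z ` H)"
    then obtain u where u: "(\<Sum>v\<in>z ` H. (\<lambda>x. u v * v x)) = 0" "\<exists>v\<in>z ` H. u v \<noteq> 0"
      using iffD1[OF Q.dependent_finite[OF finite_imageI[OF finH]] dep] by blast
    define N where "N = {F \<in> H. u (z F) \<noteq> 0}"
    have N: "finite N" "N \<noteq> {}"
      using u(2) finH by (auto simp: N_def)
    \<comment> \<open>\<open>F\<close> is the last facet with a nonzero coefficient; evaluated
      there, the relation leaves only the coefficient of \<open>z F\<close>.\<close>
    obtain F where F: "F \<in> N" "\<And>G. G \<in> N \<Longrightarrow> pos G \<le> pos F"
      using Max_in[of "pos ` N"] Max_ge[of "pos ` N"] N by fastforce
    have sum_at: "(\<Sum>G\<in>A. (\<lambda>x. u (z G) * z G x)) y = (\<Sum>G\<in>A. u (z G) * z G y)" if "finite A" for A y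
      using that by (induction A rule: finite_induct) auto
    have "0 = (\<Sum>G\<in>H. u (z G) * z G F)"
      using fun_cong[OF u(1), of F] sum_at[OF finH] by (simp add: sum.reindex[OF inj])
    also have "\<dots> = (\<Sum>G\<in>H. if G = F then u (z F) else 0)"
    proof (intro sum.cong refl)
      fix G assume G: "G \<in> H"
      show "u (z G) * z G F = (if G = F then u (z F) else 0)"
      proof (cases "G = F \<or> u (z G) = 0")
        case False
        then have "\<not> pos F < pos G"
          using F(2)[of G] G by (auto simp: N_def)
        then have "z G F = 0"
          using z(1)[OF G, of F] False by auto
        then show ?thesis
          using False by simp
      qed (use z(3) F(1) in \<open>auto simp: N_def\<close>)
    qed
    also have "\<dots> = u (z F)"
      using finH F(1) by (simp add: N_def)
    finally show False
      using F(1) by (simp add: N_def)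
  qed
  have "f \<in> Q.span (z ` H)" if "f \<in> Z" "\<And>x. f x \<noteq> 0 \<Longrightarrow> pos x < t" for f t
    using that
  proof (induction t arbitrary: f)
    case 0
    then have "f = 0" by (auto simp: fun_eq_iff)
    then show ?case
      by (simp only: Q.span_zero)
  next
    case (Suc t)
    have fO: "f x \<noteq> 0 \<Longrightarrow> x \<in> facets" for x
      using Suc.prems(1) by (auto simp: Z_def chains_def)
    show ?case
    proof (cases "\<exists>F. f F \<noteq> 0 \<and> pos F = t")
      case False
      then have "pos x < t" if "f x \<noteq> 0" for x
        using Suc.prems(2)[OF that] that by (metis less_Suc_eq)
      then show ?thesis
        using Suc.IH Suc.prems(1) by blast
    next
      case True
      then obtain F where F: "f F \<noteq> 0" "pos F = t" by blast
      note FO = fO[OF F(1)]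
      \<comment> \<open>An ascent \<open>i\<close> would give a ridge of \<open>F\<close> lying in
        no other facet of the support of \<open>f\<close>, so the boundary of \<open>f\<close> could
        not vanish there.\<close>
      have "asc F = {}"
      proof (rule ccontr)
        assume "asc F \<noteq> {}"
        then obtain i where i: "i \<in> asc F" by blast
        have im: "i \<le> m"
          using asc_le FO i by blast
        have "bdry P (Suc m) f (del_nth i F) = (-1) ^ i * f F"
        proof (rule bdry_at_isolated_face[OF finite_P FO])
          show "i < Suc m" using im by simp
          fix G j assume G: "G \<in> facets" "j < Suc m" "del_nth j G = del_nth i F" "G \<noteq> F"
          show "f G = 0"
          proof (rule ccontr)
            assume "f G \<noteq> 0"
            then have "pos G \<le> pos F"
              using Suc.prems(2) F(2) by fastforce
            \<comment> \<open>A single ridge is the case of two equal ascents in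
              \<open>first_le\<close>.\<close>
            moreover have "set F - {F ! i, F ! i} \<subseteq> set G"
              using set_del_nth[of F i] set_del_nth[of G j] G im ord_simplicesD[OF FO] ord_simplicesD[OF G(1)]
              by auto
            ultimately show False
              using first_le[OF FO G(1) i i] G(4) by blast
          qed
        qed
        then show False
          using F(1) Suc.prems(1) by (simp add: Z_def)
      qed
      then have FH: "F \<in> H"
        using FO by (simp add: H_def)
      define g where "g = (\<lambda>x. f x - f F * z F x)"
      have "bdry P (Suc m) g = (\<lambda>_. 0)"
        unfolding g_def bdry_diff_scale z(2)[OF FH] using Suc.prems(1) by (simp add: Z_def)
      moreover have g: "x \<in> facets \<and> pos x < t" if "g x \<noteq> 0" for x
      proof -
        have "x \<noteq> F"
          using that z(3)[OF FH] by (auto simp: g_def)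
        moreover have x: "x \<in> facets \<and> pos x \<le> t"
        proof (cases "f x = 0")
          case True
          then have "z F x \<noteq> 0"
            using that by (auto simp: g_def)
          then show ?thesis
            using z(1)[OF FH] F(2) by fastforce
        next
          case False
          then show ?thesis
            using fO Suc.prems(2) by fastforce
        qed
        ultimately show ?thesis
          using inj_pos FO F(2) by (metis inj_onD le_neq_implies_less)
      qed
      ultimately have "g \<in> Q.span (z ` H)"
        using Suc.IH[of g] by (auto simp: Z_def chains_def)
      then have "g + (\<lambda>x. f F * z F x) \<in> Q.span (z ` H)"
        using FH by (rule Q.span_add[OF _ Q.span_scale[OF Q.span_base[OF imageI]]])
      also have "g + (\<lambda>x. f F * z F x) = f"
        by (simp add: g_def fun_eq_iff)
      finally show ?thesis .
    qed
  qed
  moreover have "\<exists>t. \<forall>x. f x \<noteq> 0 \<longrightarrow> pos x < t" if "f \<in> Z" for f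
  proof -
    have "pos x \<le> Max (pos ` facets)" if "f x \<noteq> 0" for x
      using that \<open>f \<in> Z\<close> finite_ord_simplices[OF finite_P] by (intro Max_ge) (auto simp: Z_def chains_def)
    then show ?thesis
      by (meson le_imp_less_Suc)
  qed
  ultimately have "Z \<subseteq> Q.span (z ` H)"
    by blast
  then have "qdim Z = card (z ` H)"
    using Q.dim_unique[OF zZ _ indep refl] by blast
  then show ?thesis
    using card_image[OF inj] by (simp add: Z_def H_def)
qed

end

section \<open>Components and steps in chordal building sets\<close>

locale chordal_building =
  fixes S :: "nat set" and B :: "nat set set"
  assumes building: "building_set S B"
    and chordal_B: "chordal B"
begin

lemma finite_S: "finite S"
  using building by (simp add: building_set_def)

lemma B_D:
  assumes "J \<in> B"
  shows "J \<noteq> {}" "J \<subseteq> S" "finite J"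
  using assms building by (auto simp: building_set_def intro: finite_subset)

lemma B_Un: "I \<in> B \<Longrightarrow> J \<in> B \<Longrightarrow> x \<in> I \<Longrightarrow> x \<in> J \<Longrightarrow> I \<union> J \<in> B"
  using building unfolding building_set_def by blast

lemma B_Union:
  assumes "finite \<F>" "\<F> \<noteq> {}" "\<And>J. J \<in> \<F> \<Longrightarrow> J \<in> B \<and> x \<in> J"
  shows "\<Union>\<F> \<in> B"
  using assms
proof (induction \<F> rule: finite_ne_induct)
  case (insert J \<F>)
  then obtain K where "K \<in> \<F>" by blast
  then show ?case
    using insert B_Un[of J "\<Union>\<F>" x] by auto
qed auto

text \<open>Extends chordality to the two end points: at the minimum the upper part is all of
  \<open>C\<close>, at the maximum it is a singleton.\<close>

lemma chordal_upper:
  assumes "C \<in> B" "j \<in> C"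
  shows "{x \<in> C. j \<le> x} \<in> B"
proof -
  note D = B_D[OF assms(1)]
  consider "j = Min C" | "j = Max C" | "j \<noteq> Min C" "j \<noteq> Max C" by blast
  then show ?thesis
  proof cases
    case 1
    then have "{x \<in> C. j \<le> x} = C"
      using D by auto
    then show ?thesis
      using assms by simp
  next
    case 2
    have "x = j" if "x \<in> C" "j \<le> x" for x
      unfolding 2 using that D(3) Max_ge[of C x] by (simp add: 2 order_antisym)
    then have "{x \<in> C. j \<le> x} = {j}"
      using assms(2) by auto
    then show ?thesis
      using building D assms(2) by (auto simp: building_set_def)
  next
    case 3
    then show ?thesis
      using chordal_B assms by (auto simp: chordal_def)
  qed
qed

text \<open>The members united here share \<open>x\<close>, so for \<open>x\<close> in
  \<open>I\<close> and \<open>I\<close> inside \<open>S\<close> the union is again a member;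
  \<open>components_restr\<close> identifies these sets with the connected components.\<close>

definition component :: "nat set \<Rightarrow> nat \<Rightarrow> nat set" where
  "component I x = \<Union>{J \<in> B. J \<subseteq> I \<and> x \<in> J}"

lemma component_subset: "component I x \<subseteq> I"
  by (auto simp: component_def)

lemma component_greatest: "J \<in> B \<Longrightarrow> J \<subseteq> I \<Longrightarrow> x \<in> J \<Longrightarrow> J \<subseteq> component I x"
  by (auto simp: component_def)

lemma component_mono: "I \<subseteq> J \<Longrightarrow> component I x \<subseteq> component J x"
  by (auto simp: component_def)

lemma component_self:
  assumes "I \<subseteq> S" "x \<in> I"
  shows "x \<in> component I x"
proof -
  have "{x} \<in> B"
    using building assms by (auto simp: building_set_def)
  then show ?thesis
    using component_greatest[of "{x}"] assms by auto
qed

lemma component_in_B: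
  assumes "I \<subseteq> S" "x \<in> I"
  shows "component I x \<in> B"
  unfolding component_def
proof (rule B_Union)
  show "finite {J \<in> B. J \<subseteq> I \<and> x \<in> J}"
    using B_D finite_S by (auto intro!: finite_subset[of _ "Pow S"])
  show "{J \<in> B. J \<subseteq> I \<and> x \<in> J} \<noteq> {}"
    using component_self[OF assms] by (auto simp: component_def)
qed auto

text \<open>Each of the two components is a member through the base point of the other, so
  maximality gives both inclusions. Hence the components of \<open>I\<close> partition
  \<open>I\<close>.\<close>

lemma component_eq:
  assumes "I \<subseteq> S" "y \<in> component I x" "x \<in> I"
  shows "component I y = component I x"
proof
  have y: "y \<in> I"
    using assms component_subset by blast
  show sub: "component I x \<subseteq> component I y"
    using component_in_B[OF assms(1,3)] component_subset assms(2) by (intro component_greatest)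
  then show "component I y \<subseteq> component I x"
    using component_in_B[OF assms(1) y] component_self[OF assms(1,3)] component_subset by (intro component_greatest) auto
qed

lemma components_restr:
  assumes "I \<subseteq> S"
  shows "components (restr B I) = component I ` I"
proof (intro equalityI subsetI)
  fix C assume C: "C \<in> components (restr B I)"
  then have CB: "C \<in> B" "C \<subseteq> I"
    by (auto simp: components_def restr_def)
  then obtain x where x: "x \<in> C"
    using B_D by blast
  have "component I x \<in> restr B I"
    using component_in_B[OF assms] component_subset x CB by (auto simp: restr_def)
  then have "component I x = C"
    using C component_greatest[OF CB x] by (auto simp: components_def)
  then show "C \<in> component I ` I"
    using x CB by auto
next
  fix C assume "C \<in> component I ` I"
  then obtain x where x: "x \<in> I" "C = component I x" by blast
  have "C \<in> B" "C \<subseteq> I" "x \<in> C"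
    using x component_in_B component_subset component_self assms by auto
  moreover have "J = C" if "J \<in> B" "J \<subseteq> I" "C \<subseteq> J" for J
    using that component_greatest[of J I x] x \<open>x \<in> C\<close> by blast
  ultimately show "C \<in> components (restr B I)"
    by (auto simp: components_def restr_def)
qed

section \<open>Parity in \<open>Phat S B\<close>\<close>

lemma Phat_iff: "I \<in> Phat S B \<longleftrightarrow> I \<subseteq> S \<and> (\<forall>x\<in>I. even (card (component I x)))"
  by (auto simp: Phat_def components_restr)

lemma Phat_subset: "I \<in> Phat S B \<Longrightarrow> I \<subseteq> S"
  by (simp add: Phat_iff)

lemma Phat_finite: "I \<in> Phat S B \<Longrightarrow> finite I"
  using Phat_subset finite_S finite_subset by blast

text \<open>Such a \<open>K\<close> is a disjoint union of components of \<open>I\<close>, each of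
  even size.\<close>

lemma even_card_closed:
  assumes "I \<in> Phat S B" "K \<subseteq> I" "\<And>x. x \<in> K \<Longrightarrow> component I x \<subseteq> K"
  shows "even (card K)"
proof -
  note IS = Phat_subset[OF assms(1)]
  have K: "K = \<Union>(component I ` K)"
    using assms(2,3) component_self[OF IS] by blast
  have "2 dvd card (\<Union>(component I ` K))"
  proof (rule dvd_partition)
    show "finite (\<Union>(component I ` K))"
      using K assms(1,2) Phat_finite finite_subset by metis
    show "\<forall>c\<in>component I ` K. 2 dvd card c"
      using assms(1,2) by (auto simp: Phat_iff)
    show "\<forall>c1\<in>component I ` K. \<forall>c2\<in>component I ` K. c1 \<noteq> c2 \<longrightarrow> c1 \<inter> c2 = {}"
      using component_eq[OF IS] assms(2) by blast
  qed
  then show ?thesis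
    using K by simp
qed

lemma even_card_Phat: "I \<in> Phat S B \<Longrightarrow> even (card I)"
  by (rule even_card_closed) (use component_subset in auto)

text \<open>A component of \<open>J\<close> contains the \<open>I\<close>-component of each of its
  points in \<open>I\<close>, so it meets \<open>I\<close> in a union of components of
  \<open>I\<close>.\<close>

lemma even_card_component_Int:
  assumes "I \<in> Phat S B" "I \<subseteq> J" "J \<subseteq> S" "x \<in> J"
  shows "even (card (component J x \<inter> I))"
proof (rule even_card_closed[OF assms(1)])
  fix y assume "y \<in> component J x \<inter> I"
  then show "component I y \<subseteq> component J x \<inter> I"
    using component_eq[OF assms(3) _ assms(4), of y] component_mono[OF assms(2)] component_subset by blast
qed auto

lemma card_component_split:
  assumes "I \<subseteq> J" "J \<subseteq> S"
  shows "card (component J x) = card (component J x \<inter> I) + card (component J x - I)"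
proof -
  have "finite (component J x)"
    using component_subset assms finite_S by (meson finite_subset)
  then show ?thesis
    by (subst card_Un_disjoint[symmetric]) (auto intro: arg_cong[where f = card])
qed

lemma even_card_component_Diff:
  assumes "I \<in> Phat S B" "J \<in> Phat S B" "I \<subseteq> J" "x \<in> J"
  shows "even (card (component J x - I))"
proof -
  have "even (card (component J x))" "J \<subseteq> S"
    using assms(2,4) by (auto simp: Phat_iff)
  then show ?thesis
    using card_component_split[OF assms(3), of x] even_card_component_Int[OF assms(1,3) _ assms(4)] by simp
qed

section \<open>Steps of two elements and their labels\<close>

definition step :: "nat set \<Rightarrow> nat set \<Rightarrow> bool" where
  "step I K \<longleftrightarrow> I \<in> Phat S B \<and> K \<in> Phat S B \<and> I \<subseteq> K \<and> card (K - I) = 2"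

definition hi :: "nat set \<Rightarrow> nat set \<Rightarrow> nat" where "hi I K = Max (K - I)"
definition lo :: "nat set \<Rightarrow> nat set \<Rightarrow> nat" where "lo I K = Min (K - I)"
definition peak :: "nat set \<Rightarrow> nat set \<Rightarrow> nat" where "peak I K = Max (component K (hi I K))"

definition label :: "nat set \<Rightarrow> nat set \<Rightarrow> nat \<times> nat \<times> nat" where
  "label I K = (peak I K, hi I K, lo I K)"

lemma hi_lo_eq:
  assumes "a < b" "a \<notin> I" "b \<notin> I" "K = I \<union> {a, b}"
  shows "hi I K = b" "lo I K = a" "card (K - I) = 2"
proof -
  have "K - I = {a, b}"
    using assms by auto
  then show "hi I K = b" "lo I K = a" "card (K - I) = 2"
    using assms(1) by (auto simp: hi_def lo_def)
qed

lemma stepD: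
  assumes "step I K"
  shows "K = I \<union> {lo I K, hi I K}" "lo I K < hi I K" "lo I K \<notin> I" "hi I K \<notin> I"
    "lo I K \<in> K" "hi I K \<in> K" "K \<subseteq> S" "finite K" "component K (lo I K) = component K (hi I K)"
proof -
  have IK: "I \<in> Phat S B" "K \<in> Phat S B" "I \<subseteq> K" "card (K - I) = 2"
    using assms by (auto simp: step_def)
  show KS: "K \<subseteq> S" "finite K"
    using IK Phat_subset Phat_finite by auto
  obtain a b where ab: "K - I = {a, b}" "a < b"
    using IK(4) by (metis card_2_iff insert_commute linorder_neqE_nat)
  have KI: "K = I \<union> {a, b}" "a \<notin> I" "b \<notin> I"
    using ab IK(3) by auto
  have eq: "lo I K = a" "hi I K = b"
    using hi_lo_eq[OF ab(2) KI(2,3,1)] by auto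
  show "K = I \<union> {lo I K, hi I K}" "lo I K < hi I K" "lo I K \<notin> I" "hi I K \<notin> I"
    "lo I K \<in> K" "hi I K \<in> K"
    unfolding eq using KI ab(2) by auto
  \<comment> \<open>Otherwise the component of \<open>b\<close> would contain exactly one element
    outside \<open>I\<close>, against parity.\<close>
  have "a \<in> component K b"
  proof (rule ccontr)
    assume "a \<notin> component K b"
    then have "component K b - I = {b}"
      using KI component_self[OF KS(1), of b] component_subset[of K b] by auto
    then show False
      using even_card_component_Diff[OF IK(1-3), of b] KI by auto
  qed
  then show "component K (lo I K) = component K (hi I K)"
    unfolding eq using component_eq[OF KS(1)] KI by auto
qed

lemma step_card:
  assumes "step I K"
  shows "card K = card I + 2"
proof -
  have IK: "I \<subseteq> K" "finite I" "finite K" "card (K - I) = 2"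
    using assms Phat_finite by (auto simp: step_def)
  then show ?thesis
    using card_Diff_subset[OF IK(2,1)] card_mono[OF IK(3,1)] by simp
qed

text \<open>Each component of \<open>K\<close> contains both new elements or neither, and meets
  \<open>I\<close> in an even number of points, so all components of \<open>K\<close> are
  even.\<close>

lemma stepI:
  assumes "I \<in> Phat S B" "a < b" "a \<notin> I" "b \<notin> I" "a \<in> S" "b \<in> S"
    and K: "K = I \<union> {a, b}" and ab: "a \<in> component K b"
  shows "step I K" "hi I K = b" "lo I K = a"
proof -
  note hl = hi_lo_eq[OF assms(2-4) K]
  show "hi I K = b" "lo I K = a"
    by (rule hl)+
  have KS: "K \<subseteq> S"
    using K assms Phat_subset by auto
  have bc: "b \<in> component K b"
    using component_self[OF KS] K by auto
  have "even (card (component K x))" if x: "x \<in> K" for x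
  proof -
    have "component K x - I = {} \<or> component K x - I = {a, b}"
    proof (cases "a \<in> component K x \<or> b \<in> component K x")
      case True
      then have "component K x = component K b"
        using component_eq[OF KS _ x] component_eq[OF KS ab] K by auto
      then show ?thesis
        using ab bc component_subset[of K b] K assms(3,4) by auto
    next
      case False
      then show ?thesis
        using component_subset[of K x] K by auto
    qed
    then have "even (card (component K x - I))"
      using assms(2) by (metis card.empty card_2_iff dvd_0_right dvd_refl less_irrefl)
    moreover have "I \<subseteq> K"
      using K by blast
    ultimately show ?thesis
      using card_component_split[OF _ KS, of I x] even_card_component_Int[OF assms(1) _ KS x] by simp
  qed
  then have "K \<in> Phat S B"
    using KS by (simp add: Phat_iff)
  then show "step I K"
    using assms(1) K hl(3) by (auto simp: step_def)
qed

lemma component_Max_in: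
  assumes "I \<subseteq> S" "x \<in> I"
  shows "Max (component I x) \<in> component I x" "y \<in> component I x \<Longrightarrow> y \<le> Max (component I x)"
  using B_D[OF component_in_B[OF assms]] by auto

text \<open>The maximum lies in its component, so within one set it names the component; this is why
  a label needs to record only \<open>peak\<close>.\<close>

lemma component_eq_if_Max_eq:
  assumes "I \<subseteq> S" "x \<in> I" "y \<in> I" "Max (component I x) = Max (component I y)"
  shows "component I x = component I y"
proof -
  have "component I x = component I (Max (component I x))"
    using component_eq[OF assms(1) component_Max_in(1)[OF assms(1,2)] assms(2)] by (rule sym)
  also have "\<dots> = component I y"
    unfolding assms(4) by (rule component_eq[OF assms(1) component_Max_in(1)[OF assms(1,3)] assms(3)])
  finally show ?thesis .
qed

lemma Max_component_mono:
  assumes "I \<subseteq> J" "J \<subseteq> S" "x \<in> I"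
  shows "Max (component I x) \<le> Max (component J x)"
  using component_Max_in(1)[of I x] component_Max_in(2)[of J x] component_mono[OF assms(1), of x] assms by blast

lemma label_inj:
  assumes "step I K" "step I K'" "label I K = label I K'"
  shows "K = K'"
proof -
  have eq: "lo I K = lo I K'" "hi I K = hi I K'"
    using assms(3) by (simp_all add: label_def)
  have "K = I \<union> {lo I K, hi I K}"
    using stepD(1)[OF assms(1)] .
  also have "\<dots> = K'"
    unfolding eq using stepD(1)[OF assms(2)] by (rule sym)
  finally show ?thesis .
qed

section \<open>The greedy first step of an interval\<close>

definition greedy :: "nat set \<Rightarrow> nat set \<Rightarrow> nat set \<Rightarrow> bool" where
  "greedy I K J \<longleftrightarrow> step I K \<and> K \<subseteq> J \<and> J \<subseteq> S \<and>
     (\<forall>y\<in>component J (hi I K) - I. y = hi I K \<or> y \<le> lo I K) \<and>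
     (\<forall>y\<in>J - I. Max (component J y) \<le> Max (component J (hi I K)))"

lemma greedyD:
  assumes "greedy I K J"
  shows "step I K" "K \<subseteq> J" "J \<subseteq> S" "hi I K \<in> J" "lo I K \<in> component J (hi I K)"
    "y \<in> component J (hi I K) \<Longrightarrow> y \<notin> I \<Longrightarrow> y = hi I K \<or> y \<le> lo I K"
    "y \<in> J \<Longrightarrow> y \<notin> I \<Longrightarrow> Max (component J y) \<le> Max (component J (hi I K))"
proof -
  show g: "step I K" "K \<subseteq> J" "J \<subseteq> S"
    "y \<in> component J (hi I K) \<Longrightarrow> y \<notin> I \<Longrightarrow> y = hi I K \<or> y \<le> lo I K"
    "y \<in> J \<Longrightarrow> y \<notin> I \<Longrightarrow> Max (component J y) \<le> Max (component J (hi I K))"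
    using assms by (auto simp: greedy_def)
  note D = stepD[OF g(1)]
  show "hi I K \<in> J"
    using D(6) g(2) by blast
  show "lo I K \<in> component J (hi I K)"
    using component_self[OF D(7,5)] D(9) component_mono[OF g(2)] by auto
qed

text \<open>By chordality the elements from \<open>lo I K\<close> upwards in the component of
  \<open>J\<close> form a member. It lies in \<open>K\<close> and contains the maximum, so enlarging
  \<open>K\<close> to \<open>J\<close> does not raise the peak.\<close>

lemma peak_greedy:
  assumes "greedy I K J"
  shows "peak I K = Max (component J (hi I K))"
proof -
  note g = greedyD[OF assms]
  note D = stepD[OF g(1)]
  define C where "C = component J (hi I K)"
  have CB: "C \<in> B"
    unfolding C_def using component_in_B g by blast
  \<comment> \<open>\<open>A\<close> is contained in \<open>K\<close>, since \<open>K\<close> contains the two largest elements of \<open>C - I\<close>.\<close>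
  define A where "A = {x \<in> C. lo I K \<le> x}"
  have AB: "A \<in> B"
    unfolding A_def using chordal_upper[OF CB] g(5) by (simp add: C_def)
  have "hi I K \<in> C"
    unfolding C_def using component_self g by blast
  moreover have "A \<subseteq> K"
  proof
    fix x assume x: "x \<in> A"
    show "x \<in> K"
    proof (cases "x \<in> I")
      case False
      then have "x = hi I K \<or> x = lo I K"
        using g(6)[of x] x by (auto simp: A_def C_def)
      then show ?thesis
        using D(5,6) by auto
    qed (use D(1) in blast)
  qed
  ultimately have "A \<subseteq> component K (hi I K)"
    using component_greatest[OF AB] D(2) by (auto simp: A_def)
  moreover have "Max C \<in> A"
    unfolding A_def using component_Max_in[OF g(3,4)] g(5) by (auto simp: C_def)
  ultimately have "Max C \<le> Max (component K (hi I K))"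
    using component_Max_in(2)[OF D(7,6)] by auto
  then show ?thesis
    using Max_component_mono[OF g(2,3) D(6)] by (simp add: peak_def C_def)
qed

text \<open>Parity leaves at least two missing elements in the chosen component, and chordality
  connects the top two inside \<open>K\<close>. In particular \<open>step\<close> is the cover
  relation of \<open>Phat S B\<close>.\<close>

lemma greedy_exists:
  assumes "I \<in> Phat S B" "J \<in> Phat S B" "I \<subset> J"
  shows "\<exists>K. greedy I K J"
proof -
  have J: "J \<subseteq> S" "finite J"
    using assms Phat_subset Phat_finite by auto
  obtain y where y: "y \<in> J - I" "\<And>z. z \<in> J - I \<Longrightarrow> Max (component J z) \<le> Max (component J y)"
    using assms(3) J(2) Max_in[of "(\<lambda>z. Max (component J z)) ` (J - I)"]
      Max_ge[of "(\<lambda>z. Max (component J z)) ` (J - I)"] by fastforce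
  define C where "C = component J y"
  have yC: "y \<in> C"
    unfolding C_def using component_self J y by auto
  have C: "C \<in> B" "C \<subseteq> J" "finite (C - I)"
    using component_in_B[OF J(1)] component_subset y(1) B_D by (auto simp: C_def)
  define b where "b = Max (C - I)"
  define a where "a = Max (C - I - {b})"
  have b: "b \<in> C - I" "\<And>z. z \<in> C - I \<Longrightarrow> z \<le> b"
    unfolding b_def using C(3) yC y(1) Max_in[of "C - I"] by auto
  have "even (card (C - I))"
    using even_card_component_Diff[OF assms(1,2)] assms(3) y(1) by (auto simp: C_def)
  then have "C - I \<noteq> {b}"
    by auto
  then have "C - I - {b} \<noteq> {}"
    using b(1) by blast
  then have a: "a \<in> C - I - {b}" "\<And>z. z \<in> C - I - {b} \<Longrightarrow> z \<le> a"
    unfolding a_def using C(3) Max_in[of "C - I - {b}"] by auto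
  then have ab: "a < b"
    using b(2)[of a] by auto
  define K where "K = I \<union> {a, b}"
  have KJ: "K \<subseteq> J"
    using a(1) b(1) C(2) assms(3) by (auto simp: K_def)
  have "{x \<in> C. a \<le> x} \<subseteq> component K b"
  proof (rule component_greatest)
    show "{x \<in> C. a \<le> x} \<in> B"
      using chordal_upper C(1) a(1) by blast
    \<comment> \<open>Apart from \<open>a\<close> and \<open>b\<close>, every element of
      \<open>C\<close> from \<open>a\<close> upwards is already in \<open>I\<close>.\<close>
    show "{x \<in> C. a \<le> x} \<subseteq> K"
    proof
      fix x assume x: "x \<in> {x \<in> C. a \<le> x}"
      show "x \<in> K"
      proof (cases "x \<in> I \<or> x = b")
        case False
        then have "x = a"
          using a(2)[of x] x by auto
        then show ?thesis
          by (simp add: K_def)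
      qed (auto simp: K_def)
    qed
  qed (use ab b(1) in auto)
  then have "a \<in> component K b"
    using a(1) by auto
  then have st: "step I K" "hi I K = b" "lo I K = a"
    using stepI[OF assms(1) ab _ _ _ _ K_def] a(1) b(1) C(2) J(1) by auto
  have "component J b = C"
    using component_eq[OF J(1), of b y] b(1) y(1) by (auto simp: C_def)
  then have "greedy I K J"
    unfolding greedy_def st(2,3) using st(1) KJ J(1) a(2) y(2) by (auto simp: C_def)
  then show ?thesis
    by blast
qed

text \<open>The peak of \<open>K'\<close> is at most the maximum of its component in
  \<open>J\<close>, hence at most the peak of \<open>K\<close>. A tie puts both steps in the same
  component of \<open>J\<close>, where \<open>hi I K\<close> and \<open>lo I K\<close> are the two
  largest missing elements.\<close>

lemma greedy_first:
  assumes "greedy I K J" "step I K'" "K' \<subseteq> J" "K' \<noteq> K"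
  shows "label I K' < label I K"
proof -
  note g = greedyD[OF assms(1)]
  note D = stepD[OF g(1)] and D' = stepD[OF assms(2)]
  have hJ: "hi I K' \<in> J"
    using D'(6) assms(3) by blast
  have le: "peak I K' \<le> Max (component J (hi I K'))"
    unfolding peak_def using Max_component_mono[OF assms(3) g(3) D'(6)] .
  have le2: "Max (component J (hi I K')) \<le> peak I K"
    using g(7)[OF hJ D'(4)] peak_greedy[OF assms(1)] by simp
  show ?thesis
  proof (cases "peak I K' = peak I K")
    case True
    then have "Max (component J (hi I K')) = Max (component J (hi I K))"
      using le le2 peak_greedy[OF assms(1)] by simp
    then have eq: "component J (hi I K') = component J (hi I K)"
      using component_eq_if_Max_eq[OF g(3) hJ g(4)] by simp
    have h: "hi I K' = hi I K \<or> hi I K' \<le> lo I K"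
      using g(6)[OF _ D'(4)] component_self[OF g(3) hJ] eq by simp
    have "lo I K' \<in> component J (hi I K)"
      using component_self[OF D'(7,5)] D'(9) component_mono[OF assms(3)] eq by auto
    then have l: "lo I K' = hi I K \<or> lo I K' \<le> lo I K"
      using g(6)[OF _ D'(3)] by simp
    have "\<not> (hi I K' = hi I K \<and> lo I K' = lo I K)"
      using label_inj[OF g(1) assms(2)] True assms(4) by (auto simp: label_def)
    then show ?thesis
      using h l D(2) D'(2) True by (auto simp: label_def less_prod_def)
  next
    case False
    then show ?thesis
      using le le2 by (auto simp: label_def less_prod_def)
  qed
qed

section \<open>Ascents as greedy steps\<close>

definition ascent :: "nat set \<Rightarrow> nat set \<Rightarrow> nat set \<Rightarrow> bool" where
  "ascent I K J \<longleftrightarrow> peak K J < peak I K \<or> peak K J = peak I K \<and> hi K J < lo I K"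

text \<open>The step to \<open>J\<close> can use only what the greedy \<open>K\<close> left over: no
  larger peak and, in the same component, only elements below \<open>lo I K\<close>.\<close>

lemma greedy_ascent:
  assumes "greedy I K J" "step K J"
  shows "ascent I K J"
proof -
  note g = greedyD[OF assms(1)]
  note D = stepD[OF g(1)] and D' = stepD[OF assms(2)]
  have nI: "hi K J \<notin> I"
    using D'(4) D(1) by blast
  have le: "peak K J \<le> peak I K"
    using g(7)[OF D'(6) nI] peak_greedy[OF assms(1)] by (simp add: peak_def)
  show ?thesis
  proof (cases "peak K J = peak I K")
    case True
    then have "component J (hi K J) = component J (hi I K)"
      using component_eq_if_Max_eq[OF g(3) D'(6) g(4)] peak_greedy[OF assms(1)] by (simp add: peak_def)
    then have "hi K J = hi I K \<or> hi K J \<le> lo I K"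
      using g(6)[OF _ nI] component_self[OF g(3) D'(6)] by simp
    moreover have "hi K J \<noteq> hi I K" "hi K J \<noteq> lo I K"
      using D'(4) D(5,6) by metis+
    ultimately show ?thesis
      using True by (auto simp: ascent_def)
  qed (use le in \<open>auto simp: ascent_def\<close>)
qed

text \<open>Starting point for \<open>greedy_extend\<close>: a single step has no
  competitor.\<close>

lemma greedy_refl:
  assumes "step I K"
  shows "greedy I K K"
proof -
  note D = stepD[OF assms]
  have "y = lo I K \<or> y = hi I K" if "y \<in> K - I" for y
    using that D(1) by blast
  then show ?thesis
    using assms D(2,7,9) component_subset[of K] by (fastforce simp: greedy_def)
qed

text \<open>With \<open>greedy_refl\<close> this gives the converse of \<open>greedy_ascent\<close>;
  applied twice it covers two consecutive ascents. Elements of \<open>J\<close> outside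
  \<open>K1\<close> are controlled by the greedy step from \<open>K1\<close>, whose peak is at most
  \<open>peak I K1\<close>.\<close>

lemma greedy_extend:
  assumes "greedy K1 K2 J" "step I K1" "ascent I K1 K2"
  shows "greedy I K1 J"
proof -
  note g = greedyD[OF assms(1)]
  note D1 = stepD[OF assms(2)] and D2 = stepD[OF g(1)]
  let ?b = "hi I K1" and ?a = "lo I K1"
  have K1J: "K1 \<subseteq> J"
    using D2(1) g(2) by blast
  have bJ: "?b \<in> J"
    using D1(6) K1J by blast
  have new: "y \<notin> K1 \<or> y = ?a \<or> y = ?b" if "y \<notin> I" for y
    using that D1(1) by blast
  have top1: "peak I K1 \<le> Max (component J ?b)"
    unfolding peak_def using Max_component_mono[OF K1J g(3) D1(6)] .
  have top2: "peak K1 K2 = Max (component J (hi K1 K2))"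
    using peak_greedy[OF assms(1)] .
  have asc: "peak K1 K2 \<le> peak I K1"
    using assms(3) by (auto simp: ascent_def)
  have "?a \<in> component J ?b"
    using component_self[OF D1(7,5)] D1(9) component_mono[OF K1J] by auto
  then have ca: "component J ?a = component J ?b"
    using component_eq[OF g(3) _ bJ] by simp
  have "y = ?b \<or> y \<le> ?a" if y: "y \<in> component J ?b" "y \<notin> I" for y
  proof (cases "y \<in> K1")
    case False
    have yJ: "y \<in> J"
      using y component_subset by blast
    have cy: "component J y = component J ?b"
      using component_eq[OF g(3) y(1) bJ] .
    \<comment> \<open>\<open>peak I K1\<close> is at most the maximum of the component of
      \<open>?b\<close> in \<open>J\<close>, which is at most \<open>peak K1 K2\<close>, which is at
      most \<open>peak I K1\<close>; so all are equal.\<close>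
    then have "Max (component J ?b) = Max (component J (hi K1 K2))" and eq: "peak K1 K2 = peak I K1"
      using g(7)[OF yJ False] top1 top2 asc by auto
    then have "component J ?b = component J (hi K1 K2)"
      using component_eq_if_Max_eq[OF g(3) bJ g(4)] by simp
    then have "y \<le> hi K1 K2"
      using g(6)[OF _ False] y(1) D2(2) by auto
    then show ?thesis
      using assms(3) eq by (auto simp: ascent_def)
  qed (use new y(2) in auto)
  moreover have "Max (component J y) \<le> Max (component J ?b)" if y: "y \<in> J" "y \<notin> I" for y
  proof (cases "y \<in> K1")
    case True
    then show ?thesis
      using new[OF y(2)] ca by auto
  next
    case False
    then show ?thesis
      using g(7)[OF y(1)] top1 top2 asc by auto
  qed
  ultimately show ?thesis
    using assms(2) K1J g(3) by (auto simp: greedy_def)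
qed

end

section \<open>The shelling\<close>

text \<open>\<open>m\<close> plays the role of \<open>k - 2\<close>, the dimension of the order
  complex: a facet has \<open>Suc m\<close> vertices and, with both ends added,
  \<open>Suc (Suc m)\<close> steps.\<close>

locale even_chordal_building = chordal_building +
  fixes m :: nat
  assumes card_S: "card S = 2 * Suc (Suc m)"
    and S_Phat: "S \<in> Phat S B"
begin

section \<open>Facets as chains of steps from the empty set to \<open>S\<close>\<close>

abbreviation facets where "facets \<equiv> ord_simplices (Pposet S B) (Suc m)"

text \<open>Padding by the empty set and \<open>S\<close> lets the end steps be treated like the
  others; vertex \<open>F ! i\<close> becomes level \<open>Suc i\<close>.\<close>

definition level :: "nat set list \<Rightarrow> nat \<Rightarrow> nat set" where
  "level F i = ({} # F @ [S]) ! i"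

lemma level_0: "level F 0 = {}"
  by (simp add: level_def)

lemma level_Suc: "length F = Suc m \<Longrightarrow> i \<le> m \<Longrightarrow> level F (Suc i) = F ! i"
  by (simp add: level_def nth_append)

lemma level_last: "length F = Suc m \<Longrightarrow> level F (Suc (Suc m)) = S"
  by (simp add: level_def nth_append)

lemma list_eq_if_level_eq:
  assumes "length F = Suc m" "length G = Suc m" "\<And>i. i \<le> Suc m \<Longrightarrow> level F i = level G i"
  shows "F = G"
proof (rule nth_equalityI)
  fix i assume "i < length F"
  then have "i \<le> m"
    using assms(1) by simp
  then show "F ! i = G ! i"
    using assms level_Suc[of F i] level_Suc[of G i] by simp
qed (use assms in simp)

lemma card_level_if_steps:
  assumes "\<And>i. i < j \<Longrightarrow> step (level F i) (level F (Suc i))"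
  shows "card (level F j) = 2 * j"
  using assms
proof (induction j)
  case (Suc j)
  then show ?case
    using step_card[of "level F j" "level F (Suc j)"] by simp
qed (simp add: level_0)

lemma facetI:
  assumes "length F = Suc m" "\<And>i. i \<le> Suc m \<Longrightarrow> step (level F i) (level F (Suc i))"
  shows "F \<in> facets"
proof -
  have cn: "card (F ! i) = 2 * Suc i" "F ! i \<in> Phat S B" if "i \<le> m" for i
    using card_level_if_steps[of "Suc i" F] assms(2)[of i] level_Suc[OF assms(1) that] that assms(2)
    by (auto simp: step_def)
  have "F ! i \<in> Pposet S B" if "i \<le> m" for i
    using cn[OF that] that card_S by (auto simp: Pposet_def)
  then have "set F \<subseteq> Pposet S B"
    using assms(1) by (auto simp: in_set_conv_nth less_Suc_eq_le)
  moreover have "F ! i \<subset> F ! Suc i" if "Suc i < length F" for i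
  proof -
    have "step (F ! i) (F ! Suc i)"
      using assms(2)[of "Suc i"] level_Suc[OF assms(1), of i] level_Suc[OF assms(1), of "Suc i"] that assms(1)
      by simp
    then show ?thesis
      by (auto simp: step_def)
  qed
  then have "sorted_wrt (\<subset>) F"
    by (subst sorted_wrt_iff_nth_Suc_transp) auto
  ultimately show ?thesis
    using assms(1) by (simp add: ord_simplices_def)
qed

lemma facet_length: "F \<in> facets \<Longrightarrow> length F = Suc m"
  by (rule ord_simplicesD)

lemma facet_level_Phat:
  assumes "F \<in> facets" "i \<le> Suc (Suc m)"
  shows "level F i \<in> Phat S B"
proof -
  have "set ({} # F @ [S]) \<subseteq> Phat S B"
    using ord_simplicesD(3)[OF assms(1)] S_Phat by (auto simp: Pposet_def Phat_iff)
  moreover have "level F i \<in> set ({} # F @ [S])"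
    unfolding level_def using facet_length[OF assms(1)] assms(2) by (intro nth_mem) simp
  ultimately show ?thesis
    by blast
qed

lemma facet_level_psubset:
  assumes "F \<in> facets" "i \<le> Suc m"
  shows "level F i \<subset> level F (Suc i)"
proof -
  have "sorted_wrt (\<subset>) ({} # F @ [S])"
  proof -
    have "x \<noteq> {} \<and> x \<subset> S" if "x \<in> set F" for x
      using ord_simplicesD(3)[OF assms(1)] that Phat_subset[of x] by (auto simp: Pposet_def)
    moreover have "S \<noteq> {}"
      using card_S by auto
    ultimately show ?thesis
      using ord_simplicesD(4)[OF assms(1)] by (auto simp: sorted_wrt_append)
  qed
  from sorted_wrt_nth_less[OF this, of i "Suc i"] show ?thesis
    unfolding level_def using facet_length[OF assms(1)] assms(2) by simp
qed

lemma facet_level_card_less: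
  assumes "F \<in> facets" "i \<le> Suc m"
  shows "card (level F i) + 2 \<le> card (level F (Suc i))"
proof -
  have "card (level F i) < card (level F (Suc i))"
    using facet_level_psubset[OF assms] facet_level_Phat[OF assms(1)] Phat_finite assms(2)
    by (intro psubset_card_mono) auto
  moreover have "even (card (level F i))" "even (card (level F (Suc i)))"
    using facet_level_Phat[OF assms(1)] even_card_Phat assms(2) by auto
  ultimately show ?thesis
    by presburger
qed

text \<open>Even, strictly increasing cardinalities gain at least 2 at each of the
  \<open>Suc (Suc m)\<close> steps. The total is \<open>2 * Suc (Suc m)\<close>, so each gain is
  exactly 2.\<close>

lemma facet_level_card:
  assumes "F \<in> facets" "i \<le> Suc (Suc m)"
  shows "card (level F i) = 2 * i"
proof (rule antisym)
  show "2 * i \<le> card (level F i)"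
    using assms(2)
  proof (induction i)
    case (Suc i)
    then show ?case
      using facet_level_card_less[OF assms(1), of i] by simp
  qed simp
  \<comment> \<open>The upper bound counts the same gains downwards from \<open>S\<close>.\<close>
  have "card (level F (Suc (Suc m) - j)) + 2 * j \<le> 2 * Suc (Suc m)" if "j \<le> Suc (Suc m)" for j
    using that
  proof (induction j)
    case 0
    then show ?case
      using level_last[OF facet_length[OF assms(1)]] card_S by simp
  next
    case (Suc j)
    then have "Suc (Suc m) - j = Suc (Suc (Suc m) - Suc j)"
      by simp
    then show ?case
      using facet_level_card_less[OF assms(1), of "Suc (Suc m) - Suc j"] Suc by simp
  qed
  from this[of "Suc (Suc m) - i"] show "card (level F i) \<le> 2 * i"
    using assms(2) by simp
qed

lemma facet_step:
  assumes "F \<in> facets" "i \<le> Suc m"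
  shows "step (level F i) (level F (Suc i))"
proof -
  have "card (level F (Suc i) - level F i) = 2"
    using facet_level_card[OF assms(1), of i] facet_level_card[OF assms(1), of "Suc i"] assms(2)
      facet_level_psubset[OF assms] Phat_finite[OF facet_level_Phat[OF assms(1), of i]]
    by (subst card_Diff_subset) auto
  then show ?thesis
    using facet_level_Phat[OF assms(1)] facet_level_psubset[OF assms] assms(2)
    by (auto simp: step_def)
qed

text \<open>The first \<open>Suc m\<close> labels determine every vertex, and the level after them
  is always \<open>S\<close>, so the final step contributes no entry.\<close>

definition key :: "nat set list \<Rightarrow> (nat \<times> nat \<times> nat) list" where
  "key F = map (\<lambda>i. label (level F i) (level F (Suc i))) [0..<Suc m]"

lemma key_less:
  assumes "i \<le> m" "\<And>p. p \<le> i \<Longrightarrow> level F p = level G p"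
    and "label (level F i) (level F (Suc i)) < label (level G i) (level G (Suc i))"
  shows "key F < key G"
proof -
  have "take i (key F) = take i (key G)"
    using assms(1,2) by (intro nth_equalityI) (auto simp: key_def simp del: upt_Suc)
  moreover have "key F ! i < key G ! i"
    using assms(1,3) by (simp add: key_def del: upt_Suc)
  ultimately show ?thesis
    using assms(1) unfolding list_less_def lexord_take_index_conv
    by (auto simp: key_def less_Suc_eq_le simp del: upt_Suc intro!: exI[of _ i])
qed

lemma key_inj:
  assumes "F \<in> facets" "G \<in> facets" "key F = key G"
  shows "F = G"
proof -
  have lab: "label (level F i) (level F (Suc i)) = label (level G i) (level G (Suc i))" if "i \<le> m" for i
    using arg_cong[OF assms(3), of "\<lambda>l. l ! i"] that by (simp add: key_def del: upt_Suc)
  have "level F i = level G i" if "i \<le> Suc m" for i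
    using that
  proof (induction i)
    case (Suc i)
    then have eq: "level F i = level G i" by simp
    have "step (level F i) (level F (Suc i))" "step (level F i) (level G (Suc i))"
      using facet_step[OF assms(1), of i] facet_step[OF assms(2), of i] Suc.prems eq by simp_all
    moreover have "label (level F i) (level F (Suc i)) = label (level F i) (level G (Suc i))"
      using lab[of i] Suc.prems eq by simp
    ultimately show ?case
      by (rule label_inj)
  qed (simp add: level_0)
  then show ?thesis
    using list_eq_if_level_eq facet_length assms(1,2) by blast
qed

text \<open>Facets with larger keys come first.\<close>

definition pos :: "nat set list \<Rightarrow> nat" where
  "pos F = card {H \<in> facets. key F < key H}"

text \<open>Vertex \<open>F ! i\<close> is level \<open>Suc i\<close>, so index \<open>i\<close>
  compares the steps into and out of that vertex.\<close>

definition asc :: "nat set list \<Rightarrow> nat set" where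
  "asc F = {i. i \<le> m \<and> ascent (level F i) (level F (Suc i)) (level F (Suc (Suc i)))}"

lemma finite_Pposet: "finite (Pposet S B)"
  by (rule finite_subset[of _ "Pow S"]) (auto simp: Pposet_def Phat_def finite_S)

lemma pos_less:
  assumes "G \<in> facets" "key F < key G"
  shows "pos G < pos F"
  unfolding pos_def using assms finite_ord_simplices[OF finite_Pposet]
  by (intro psubset_card_mono) auto

lemma level_eq_if_nth_eq:
  assumes "F \<in> facets" "G \<in> facets" "\<And>p. p \<le> m \<Longrightarrow> Suc p = i \<Longrightarrow> G ! p = F ! p" "i \<le> Suc (Suc m)"
  shows "level G i = level F i"
proof -
  note L = facet_length[OF assms(1)] facet_length[OF assms(2)]
  consider "i = 0" | p where "p \<le> m" "i = Suc p" | "i = Suc (Suc m)"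
    using assms(4) by (cases i) (auto simp: le_Suc_eq)
  then show ?thesis
    using assms(3) L by cases (auto simp: level_0 level_Suc level_last)
qed

text \<open>At the first vertex \<open>p\<close> where the facets differ, \<open>F\<close> starts
  greedily towards the next level that both share, so \<open>greedy_first\<close> gives
  \<open>G\<close> the smaller label there.\<close>

lemma ascent_first:
  assumes F: "F \<in> facets" and G: "G \<in> facets" and i: "i \<in> asc F" and j: "j \<in> asc F"
    and agree: "\<And>p. p \<le> m \<Longrightarrow> p \<noteq> i \<Longrightarrow> p \<noteq> j \<Longrightarrow> G ! p = F ! p" and "G \<noteq> F"
  shows "pos F < pos G"
proof -
  note LF = facet_length[OF F] and LG = facet_length[OF G]
  have "\<exists>p. p \<le> m \<and> G ! p \<noteq> F ! p"
    using \<open>G \<noteq> F\<close> LF LG by (metis less_Suc_eq_le nth_equalityI)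
  then obtain p where p: "p \<le> m" "G ! p \<noteq> F ! p" "\<And>q. q < p \<Longrightarrow> \<not> (q \<le> m \<and> G ! q \<noteq> F ! q)"
    using exists_least_iff[of "\<lambda>p. p \<le> m \<and> G ! p \<noteq> F ! p"] by blast
  have pij: "p = i \<or> p = j"
    using agree p by blast
  have low: "level G q = level F q" if "q \<le> p" for q
    using that p by (intro level_eq_if_nth_eq[OF F G]) auto
  have pasc: "ascent (level F p) (level F (Suc p)) (level F (Suc (Suc p)))"
    using pij i j by (auto simp: asc_def)
  have st: "step (level F q) (level F (Suc q))" "step (level G q) (level G (Suc q))" if "q \<le> Suc m" for q
    using facet_step F G that by auto
  have g: "greedy (level F p) (level F (Suc p)) (level F (Suc (Suc p)))"
    using greedy_extend[OF greedy_refl st(1) pasc] st(1) p(1) by simp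
  have ne: "level G (Suc p) \<noteq> level F (Suc p)"
    using p(1,2) LF LG by (simp add: level_Suc)
  have stG: "step (level F p) (level G (Suc p))"
    using st(2)[of p] low[of p] p(1) by simp
  have subG: "level G q \<subseteq> level G (Suc q)" if "q \<le> Suc m" for q
    using st(2)[OF that] by (simp add: step_def)
  have "label (level F p) (level G (Suc p)) < label (level F p) (level F (Suc p))"
  proof (cases "level G (Suc (Suc p)) = level F (Suc (Suc p))")
    case True
    then have "level G (Suc p) \<subseteq> level F (Suc (Suc p))"
      using subG[of "Suc p"] p(1) by simp
    then show ?thesis
      using greedy_first[OF g stG _ ne] by simp
  next
    \<comment> \<open>The facets differ at \<open>Suc p\<close> as well, so \<open>i\<close> and
      \<open>j\<close> are \<open>p\<close> and \<open>Suc p\<close>, and the next shared level is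
      three steps above level \<open>p\<close>.\<close>
    case False
    then have pm: "Suc p \<le> m" and d: "G ! Suc p \<noteq> F ! Suc p"
      using LF LG p(1) by (metis level_Suc level_last le_SucE le_antisym not_less_eq_eq)+
    then have pij2: "Suc p = i \<or> Suc p = j"
      using agree by blast
    then have asc2: "ascent (level F (Suc p)) (level F (Suc (Suc p))) (level F (Suc (Suc (Suc p))))"
      using i j by (auto simp: asc_def)
    have "greedy (level F (Suc p)) (level F (Suc (Suc p))) (level F (Suc (Suc (Suc p))))"
      using greedy_extend[OF greedy_refl st(1) asc2] st(1) pm by simp
    then have g2: "greedy (level F p) (level F (Suc p)) (level F (Suc (Suc (Suc p))))"
      using greedy_extend[OF _ st(1) pasc] p(1) by simp
    have "level G (Suc (Suc (Suc p))) = level F (Suc (Suc (Suc p)))"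
      using agree pij pij2 pm by (intro level_eq_if_nth_eq[OF F G]) auto
    then have "level G (Suc p) \<subseteq> level F (Suc (Suc (Suc p)))"
      using subG[of "Suc p"] subG[of "Suc (Suc p)"] pm by auto
    then show ?thesis
      using greedy_first[OF g2 stG _ ne] by simp
  qed
  then have "key G < key F"
    using key_less[OF p(1), of G F] low by simp
  then show ?thesis
    using pos_less F by blast
qed

text \<open>Replacing the vertex by the greedy step of the interval around it raises the key. The
  greedy step is a different set, since otherwise \<open>greedy_ascent\<close> would make
  \<open>i\<close> an ascent.\<close>

lemma not_ascent_earlier:
  assumes F: "F \<in> facets" and i: "i \<le> m" "i \<notin> asc F"
  shows "\<exists>G\<in>facets. pos G < pos F \<and> (\<forall>p\<le>m. p \<noteq> i \<longrightarrow> G ! p = F ! p)"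
proof -
  note LF = facet_length[OF F]
  let ?I = "level F i" and ?K = "level F (Suc i)" and ?J = "level F (Suc (Suc i))"
  have st: "step ?I ?K" "step ?K ?J"
    using facet_step[OF F] i(1) by auto
  have IJ: "?I \<subset> ?J"
    using facet_level_psubset[OF F, of i] facet_level_psubset[OF F, of "Suc i"] i(1) by auto
  have "?I \<in> Phat S B" "?J \<in> Phat S B"
    using facet_level_Phat[OF F] i(1) by auto
  then obtain K where K: "greedy ?I K ?J"
    using greedy_exists[OF _ _ IJ] by blast
  have ne: "?K \<noteq> K"
  proof
    assume "?K = K"
    then have "ascent ?I ?K ?J"
      using greedy_ascent[OF _ st(2)] K by simp
    then show False
      using i by (simp add: asc_def)
  qed
  note g = greedyD[OF K]
  have KJ: "step K ?J"
  proof -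
    have "card K = 2 * Suc i" "card ?J = 2 * Suc (Suc i)"
      using step_card[OF g(1)] facet_level_card[OF F] i(1) by auto
    moreover have "finite K"
      using stepD(8)[OF g(1)] .
    ultimately show ?thesis
      using g(1,2) facet_level_Phat[OF F, of "Suc (Suc i)"] i(1)
      by (auto simp: step_def card_Diff_subset)
  qed
  define G where "G = F[i := K]"
  have LG: "length G = Suc m"
    using LF by (simp add: G_def)
  have lG: "level G q = (if q = Suc i then K else level F q)" for q
    using LF i(1) by (auto simp: level_def G_def nth_append nth_Cons' nth_list_update)
  have "step (level G q) (level G (Suc q))" if "q \<le> Suc m" for q
    using facet_step[OF F that] g(1) KJ by (auto simp: lG)
  then have GO: "G \<in> facets"
    by (rule facetI[OF LG])
  have "label ?I ?K < label ?I K"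
    using greedy_first[OF K st(1) _ ne] st(2) by (simp add: step_def)
  then have "key F < key G"
    using key_less[OF i(1), of F G] by (simp add: lG)
  then have "pos G < pos F"
    using pos_less GO by blast
  then show ?thesis
    using GO by (auto simp: G_def)
qed

lemma shelling_Pposet: "shelling (Pposet S B) m pos asc"
proof
  show "finite (Pposet S B)"
    by (rule finite_Pposet)
  show "p = q" if "F \<in> facets" "G \<in> facets" "p \<le> m" "q \<le> m" "F ! p = G ! q" for F G p q
    using facet_level_card[OF that(1), of "Suc p"] facet_level_card[OF that(2), of "Suc q"] that
      level_Suc[OF facet_length] by simp
  show "inj_on pos facets"
  proof (rule inj_onI)
    fix F G assume FG: "F \<in> facets" "G \<in> facets" "pos F = pos G"
    then have "\<not> key F < key G" "\<not> key G < key F"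
      using pos_less by fastforce+
    then show "F = G"
      using key_inj FG by fastforce
  qed
  show "i \<le> m" if "i \<in> asc F" for F i
    using that by (simp add: asc_def)
  show "pos F < pos G"
    if "F \<in> facets" "G \<in> facets" "i \<in> asc F" "j \<in> asc F"
      "\<And>p. p \<le> m \<Longrightarrow> p \<noteq> i \<Longrightarrow> p \<noteq> j \<Longrightarrow> G ! p = F ! p" "G \<noteq> F" for F G i j
    using that by (rule ascent_first)
  show "\<exists>G\<in>facets. pos G < pos F \<and> (\<forall>p\<le>m. p \<noteq> i \<longrightarrow> G ! p = F ! p)"
    if "F \<in> facets" "i \<le> m" "i \<notin> asc F" for F i
    using that by (rule not_ascent_earlier)
qed

end

section \<open>Alternating permutations\<close>

lemma set_take_pair:
  assumes "Suc (2 * i) < length xs"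
  shows "set (take (2 * Suc i) xs) = set (take (2 * i) xs) \<union> {xs ! Suc (2 * i), xs ! (2 * i)}"
    "set (take (Suc (2 * i)) xs) = insert (xs ! (2 * i)) (set (take (2 * i) xs))"
  using assms by (auto simp: take_Suc_conv_app_nth)

context chordal_building
begin

lemma B_permutation_iff:
  "B_permutation S B xs \<longleftrightarrow> distinct xs \<and> set xs = S \<and>
     (\<forall>j<length xs. Max (set (take (Suc j) xs)) \<in> component (set (take (Suc j) xs)) (xs ! j))"
proof -
  have "(\<exists>C\<in>components (restr B T). x \<in> C \<and> y \<in> C) \<longleftrightarrow> y \<in> component T x"
    if "T \<subseteq> S" "x \<in> T" for T x y
    unfolding components_restr[OF that(1)] using component_self[OF that] component_eq[OF that(1)] that(2) by blast
  moreover have "set (take (Suc j) xs) \<subseteq> set xs" "xs ! j \<in> set (take (Suc j) xs)" if "j < length xs" for j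
    using that set_take_subset[of "Suc j" xs] by (auto simp: take_Suc_conv_app_nth)
  ultimately show ?thesis
    unfolding B_permutation_def by metis
qed

end

context even_chordal_building
begin

section \<open>Prefixes of even length as facets\<close>

definition levels :: "nat list \<Rightarrow> nat set list" where
  "levels xs = map (\<lambda>i. set (take (2 * Suc i) xs)) [0..<Suc m]"

lemma level_levels:
  assumes "length xs = 2 * Suc (Suc m)" "set xs = S" "i \<le> Suc (Suc m)"
  shows "level (levels xs) i = set (take (2 * i) xs)"
proof -
  have len: "length (levels xs) = Suc m"
    by (simp add: levels_def)
  consider "i = 0" | p where "p \<le> m" "i = Suc p" | "i = Suc (Suc m)"
    using assms(3) by (cases i) (auto simp: le_Suc_eq)
  then show ?thesis
  proof cases
    case (2 p)
    then show ?thesis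
      using level_Suc[OF len 2(1)] by (simp add: levels_def del: upt_Suc mult_Suc_right)
  next
    case 3
    then show ?thesis
      using level_last[OF len] assms by simp
  qed (simp add: level_0)
qed

definition alt_perms :: "nat list set" where
  "alt_perms = {xs. B_permutation S B xs \<and> alternating xs}"

lemma alt_perms_length:
  assumes "xs \<in> alt_perms"
  shows "length xs = 2 * Suc (Suc m)" "distinct xs" "set xs = S"
  using assms card_S distinct_card[of xs] by (auto simp: alt_perms_def B_permutation_def)

text \<open>The second new entry is the smaller one, so both prefixes have the same maximum. The
  permutation condition puts both entries into the component of that maximum in \<open>K\<close>, as
  \<open>stepI\<close> requires.\<close>

lemma alt_perms_step:
  assumes xs: "xs \<in> alt_perms" and i: "i \<le> Suc m"
    and I: "I = set (take (2 * i) xs)" "I \<in> Phat S B" and K: "K = set (take (2 * Suc i) xs)"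
  shows "step I K \<and> hi I K = xs ! (2 * i) \<and> lo I K = xs ! Suc (2 * i) \<and> peak I K = Max K"
proof -
  note L = alt_perms_length[OF xs]
  let ?a = "xs ! Suc (2 * i)" and ?b = "xs ! (2 * i)"
  have il: "Suc (2 * i) < length xs"
    using i L(1) by simp
  have K': "K = I \<union> {?a, ?b}"
    using set_take_pair(1)[OF il] I(1) K by simp
  define T where "T = insert ?b I"
  have T: "T = set (take (Suc (2 * i)) xs)"
    using set_take_pair(2)[OF il] I(1) by (simp add: T_def)
  have KT: "K = insert ?a T"
    using K' by (auto simp: T_def)
  have ab: "?a < ?b"
    using xs il by (auto simp: alt_perms_def alternating_def)
  have notin: "?a \<notin> I" "?b \<notin> I"
    using L(2) il I(1) by (auto simp: in_set_conv_nth nth_eq_iff_index_eq)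
  have KS: "K \<subseteq> S"
    using K L(3) set_take_subset by metis
  have MT: "Max T \<in> component T ?b" and MK: "Max K \<in> component K ?a"
    using xs il T K by (auto simp: alt_perms_def B_permutation_iff)
  have fT: "finite T"
    using T by simp
  have "Max K = Max T"
  proof -
    have "Max K = max ?a (Max T)"
      unfolding KT using fT by (rule Max_insert) (simp add: T_def)
    moreover have "?b \<le> Max T"
      using fT by (rule Max_ge) (simp add: T_def)
    ultimately show ?thesis
      using ab by simp
  qed
  then have "Max K \<in> component K ?b"
    using MT component_mono[of T K] KT by auto
  then have "component K ?a = component K ?b"
    using component_eq[OF KS MK] component_eq[OF KS, of "Max K" ?b] K' by auto
  then have acb: "?a \<in> component K ?b"
    using component_self[OF KS, of ?a] K' by auto
  have abS: "?a \<in> S" "?b \<in> S"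
    using KS K' by auto
  note st = stepI[OF I(2) ab notin abS K' acb]
  have "peak I K = Max K"
    unfolding peak_def st(2)
  proof (rule Max_eqI[symmetric, THEN sym])
    show "finite (component K ?b)"
      using component_subset[of K ?b] KS finite_S by (meson finite_subset)
    show "Max K \<in> component K ?b"
      by fact
    show "y \<le> Max K" if "y \<in> component K ?b" for y
      using that component_subset[of K ?b] KS finite_S by (meson Max_ge finite_subset subsetD)
  qed
  then show ?thesis
    using st by blast
qed

text \<open>Peaks are maxima of growing prefixes, so they never drop; in case of a tie, the rise
  from \<open>lo\<close> to the next \<open>hi\<close> rules out an ascent. The last claim recovers
  \<open>xs\<close> from its levels.\<close>

lemma levels_alt_perms:
  assumes xs: "xs \<in> alt_perms"
  shows "levels xs \<in> facets" "asc (levels xs) = {}"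
    "\<And>i. i \<le> Suc m \<Longrightarrow> xs ! (2 * i) = hi (level (levels xs) i) (level (levels xs) (Suc i)) \<and>
       xs ! Suc (2 * i) = lo (level (levels xs) i) (level (levels xs) (Suc i))"
proof -
  note L = alt_perms_length[OF xs]
  have lev: "level (levels xs) i = set (take (2 * i) xs)" if "i \<le> Suc (Suc m)" for i
    using level_levels[OF L(1,3) that] .
  \<comment> \<open>Membership in \<open>Phat S B\<close> is carried along the steps, since
    \<open>alt_perms_step\<close> presupposes it for the lower level.\<close>
  have Ph: "level (levels xs) i \<in> Phat S B" if "i \<le> Suc (Suc m)" for i
    using that
  proof (induction i)
    case 0
    then show ?case
      by (simp add: level_0 Phat_iff)
  next
    case (Suc i)
    then have "step (level (levels xs) i) (level (levels xs) (Suc i))"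
      using alt_perms_step[OF xs, of i "level (levels xs) i" "level (levels xs) (Suc i)"] lev[of i] lev[of "Suc i"]
      by simp
    then show ?case
      by (simp add: step_def)
  qed
  have st: "step (level (levels xs) i) (level (levels xs) (Suc i)) \<and>
      hi (level (levels xs) i) (level (levels xs) (Suc i)) = xs ! (2 * i) \<and>
      lo (level (levels xs) i) (level (levels xs) (Suc i)) = xs ! Suc (2 * i) \<and>
      peak (level (levels xs) i) (level (levels xs) (Suc i)) = Max (level (levels xs) (Suc i))"
    if "i \<le> Suc m" for i
    using alt_perms_step[OF xs that lev Ph lev] that by simp
  show "levels xs \<in> facets"
    using st by (intro facetI) (auto simp: levels_def)
  show "xs ! (2 * i) = hi (level (levels xs) i) (level (levels xs) (Suc i)) \<and>
       xs ! Suc (2 * i) = lo (level (levels xs) i) (level (levels xs) (Suc i))" if "i \<le> Suc m" for i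
    using st[OF that] by simp
  have "\<not> ascent (level (levels xs) i) (level (levels xs) (Suc i)) (level (levels xs) (Suc (Suc i)))"
    if "i \<le> m" for i
  proof -
    have "step (level (levels xs) (Suc i)) (level (levels xs) (Suc (Suc i)))"
      using st that by simp
    then have "Max (level (levels xs) (Suc i)) \<le> Max (level (levels xs) (Suc (Suc i)))"
      using st[of i] that by (intro Max_mono) (auto simp: step_def lev)
    moreover have "xs ! Suc (2 * i) < xs ! Suc (Suc (2 * i))"
      using xs L(1) that by (auto simp: alt_perms_def alternating_def)
    ultimately show ?thesis
      using st[of i] st[of "Suc i"] that by (auto simp: ascent_def)
  qed
  then show "asc (levels xs) = {}"
    by (auto simp: asc_def)
qed

lemma inj_levels: "inj_on levels alt_perms"
proof (rule inj_onI)
  fix xs ys assume xy: "xs \<in> alt_perms" "ys \<in> alt_perms" "levels xs = levels ys"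
  note L = alt_perms_length(1)[OF xy(1)] alt_perms_length(1)[OF xy(2)]
  show "xs = ys"
  proof (rule nth_equalityI)
    fix j assume j: "j < length xs"
    define i where "i = j div 2"
    have "i \<le> Suc m" "j = 2 * i \<or> j = Suc (2 * i)"
      using j L by (auto simp: i_def)
    then show "xs ! j = ys ! j"
      using levels_alt_perms(3)[OF xy(1), of i] levels_alt_perms(3)[OF xy(2), of i] xy(3) by auto
  qed (use L in simp)
qed

text \<open>The inverse map lists \<open>hi\<close> and then \<open>lo\<close> of each step. Without
  ascents the peaks increase weakly, so each peak is the maximum of its whole level; the permutation
  condition and the alternation follow from this.\<close>

lemma levels_surj:
  assumes F: "F \<in> facets" and asc: "asc F = {}"
  shows "\<exists>xs\<in>alt_perms. levels xs = F"
proof -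
  let ?b = "\<lambda>i. hi (level F i) (level F (Suc i))" and ?a = "\<lambda>i. lo (level F i) (level F (Suc i))"
  let ?t = "\<lambda>i. peak (level F i) (level F (Suc i))"
  note LF = facet_length[OF F]
  define xs where "xs = map (\<lambda>j. if even j then ?b (j div 2) else ?a (j div 2)) [0..<2 * Suc (Suc m)]"
  have len: "length xs = 2 * Suc (Suc m)"
    by (simp add: xs_def)
  have xb: "xs ! (2 * i) = ?b i" and xa: "xs ! Suc (2 * i) = ?a i" if "i \<le> Suc m" for i
  proof -
    have "2 * i < 2 * Suc (Suc m)" "Suc (2 * i) < 2 * Suc (Suc m)"
      using that by auto
    then show "xs ! (2 * i) = ?b i" "xs ! Suc (2 * i) = ?a i"
      by (simp_all add: xs_def del: upt_Suc mult_Suc_right)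
  qed
  note D = stepD[OF facet_step[OF F]]
  have tk: "set (take (2 * i) xs) = level F i" if "i \<le> Suc (Suc m)" for i
    using that
  proof (induction i)
    case (Suc i)
    then have i: "i \<le> Suc m" by simp
    have "set (take (2 * Suc i) xs) = level F i \<union> {?a i, ?b i}"
      using set_take_pair(1)[of i xs] Suc len xa[OF i] xb[OF i] by simp
    also have "\<dots> = level F (Suc i)"
      using D(1)[OF i] by (rule sym)
    finally show ?case .
  qed (simp add: level_0)
  have sS: "set xs = S"
    using tk[of "Suc (Suc m)"] len level_last[OF LF] by simp
  then have dist: "distinct xs"
    using len card_S by (intro card_distinct) simp
  have nasc: "\<not> ascent (level F i) (level F (Suc i)) (level F (Suc (Suc i)))" if "i \<le> m" for i
    using asc that by (auto simp: asc_def)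
  have tin: "?t i \<in> component (level F (Suc i)) (?b i)" if "i \<le> Suc m" for i
    unfolding peak_def using component_Max_in(1)[OF D(7,6)[OF that]] .
  have b_le: "?b i \<le> ?t i" if "i \<le> Suc m" for i
    unfolding peak_def using component_Max_in(2)[OF D(7,6)[OF that]] component_self[OF D(7,6)[OF that]] .
  have new: "y \<in> level F i \<or> y = ?a i \<or> y = ?b i" if "i \<le> Suc m" "y \<in> level F (Suc i)" for i y
    using that(2) D(1)[OF that(1)] by blast
  \<comment> \<open>An old element is bounded by the previous peak, a new one by the current
    \<open>hi\<close> and hence by the current peak.\<close>
  have t_ge: "y \<le> ?t i" if "i \<le> Suc m" "y \<in> level F (Suc i)" for i y
    using that
  proof (induction i arbitrary: y)
    case 0
    then show ?case
      using new[OF 0] D(2)[of 0] b_le[of 0] by (auto simp: level_0)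
  next
    case (Suc i)
    have "?t i \<le> ?t (Suc i)"
      using nasc[of i] Suc.prems(1) by (auto simp: ascent_def)
    then show ?case
      using new[OF Suc.prems] D(2)[OF Suc.prems(1)] b_le[OF Suc.prems(1)] Suc.IH[of y] Suc.prems(1)
      by auto
  qed
  have tMax: "Max (level F (Suc i)) = ?t i" if "i \<le> Suc m" for i
    using t_ge[OF that] tin[OF that] component_subset D(8)[OF that] by (intro Max_eqI) auto
  have "Max (set (take (Suc j) xs)) \<in> component (set (take (Suc j) xs)) (xs ! j)" if j: "j < length xs" for j
  proof -
    define i where "i = j div 2"
    have i: "i \<le> Suc m"
      using j len by (auto simp: i_def)
    then have il: "Suc (2 * i) < length xs"
      using len by simp
    have K: "set (take (2 * Suc i) xs) = level F (Suc i)"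
      using tk[of "Suc i"] i by simp
    show ?thesis
    proof (cases "even j")
      case True
      then have j2: "j = 2 * i"
        by (simp add: i_def)
      define T where "T = insert (?b i) (level F i)"
      have T: "set (take (Suc j) xs) = T"
        using set_take_pair(2)[OF il] xb[OF i] tk[of i] i j2 by (simp add: T_def)
      have KT: "y \<in> T \<or> y = ?a i" if "y \<in> level F (Suc i)" for y
        using new[OF i that] by (auto simp: T_def)
      have TK: "T \<subseteq> level F (Suc i)"
        using D(6)[OF i] facet_level_psubset[OF F i] by (auto simp: T_def)
      define C where "C = component (level F (Suc i)) (?b i)"
      have C: "C \<in> B" "?b i \<in> C" "C \<subseteq> level F (Suc i)"
        using component_in_B[OF D(7,6)[OF i]] component_self[OF D(7,6)[OF i]] component_subset by (auto simp: C_def)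
      \<comment> \<open>For a prefix of odd length, chordality is applied at \<open>?b i\<close>:
        the upper part of the component omits \<open>?a i\<close>, so it lies in \<open>T\<close>,
        and it still contains the peak.\<close>
      have "{y \<in> C. ?b i \<le> y} \<subseteq> T"
      proof
        fix y assume y: "y \<in> {y \<in> C. ?b i \<le> y}"
        then have "y \<noteq> ?a i"
          using D(2)[OF i] by auto
        then show "y \<in> T"
          using KT y C(3) by blast
      qed
      then have "{y \<in> C. ?b i \<le> y} \<subseteq> component T (?b i)"
        using C(2) by (intro component_greatest chordal_upper[OF C(1,2)]) auto
      moreover have "?t i \<in> {y \<in> C. ?b i \<le> y}"
        using tin[OF i] b_le[OF i] by (simp add: C_def)
      ultimately have tT: "?t i \<in> component T (?b i)"
        by blast
      have "Max T = ?t i"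
      proof (rule Max_eqI)
        show "finite T"
          using T[symmetric] by simp
        show "?t i \<in> T"
          using tT component_subset by blast
        show "y \<le> ?t i" if "y \<in> T" for y
          using t_ge[OF i] that TK by blast
      qed
      then show ?thesis
        using T tT xb[OF i] j2 by simp
    next
      case False
      then have j2: "j = Suc (2 * i)"
        by (simp add: i_def)
      then have "set (take (Suc j) xs) = level F (Suc i)"
        using K by simp
      then show ?thesis
        using tMax[OF i] tin[OF i] D(9)[OF i] xa[OF i] j2 by simp
    qed
  qed
  then have perm: "B_permutation S B xs"
    using dist sS by (simp add: B_permutation_iff)
  have up: "?a i < ?b (Suc i)" if "i \<le> m" for i
  proof -
    have i: "i \<le> Suc m" "Suc i \<le> Suc m"
      using that by auto
    have le: "?t i \<le> ?t (Suc i)" and eq: "?t i = ?t (Suc i) \<Longrightarrow> ?a i \<le> ?b (Suc i)"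
      using nasc[OF that] by (auto simp: ascent_def)
    show ?thesis
    proof (cases "?t i = ?t (Suc i)")
      case True
      moreover have "?a i \<noteq> ?b (Suc i)"
        using D(5)[OF i(1)] D(4)[OF i(2)] by metis
      ultimately show ?thesis
        using eq by simp
    next
      case False
      \<comment> \<open>A strictly larger peak is one of the elements just added, so it is at most
        \<open>?b (Suc i)\<close>.\<close>
      have "?t (Suc i) \<in> level F (Suc (Suc i))"
        using tin[OF i(2)] component_subset by blast
      moreover have "?t (Suc i) \<notin> level F (Suc i)"
        using t_ge[OF i(1)] le False by fastforce
      ultimately have "?t (Suc i) \<le> ?b (Suc i)"
        using new[OF i(2)] D(2)[OF i(2)] by fastforce
      then show ?thesis
        using D(2)[OF i(1)] b_le[OF i(1)] le by linarith
    qed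
  qed
  have "(even j \<longrightarrow> xs ! j > xs ! Suc j) \<and> (odd j \<longrightarrow> xs ! j < xs ! Suc j)" if j: "Suc j < length xs" for j
  proof -
    define i where "i = j div 2"
    show ?thesis
    proof (cases "even j")
      case True
      then have "j = 2 * i" "i \<le> Suc m"
        using j len by (auto simp: i_def)
      then show ?thesis
        using xa xb D(2) by simp
    next
      case False
      then have j2: "j = Suc (2 * i)" "i \<le> m"
        using j len by (auto simp: i_def elim!: oddE)
      then have "xs ! j = ?a i" "xs ! Suc j = ?b (Suc i)"
        using xa[of i] xb[of "Suc i"] by simp_all
      then show ?thesis
        using up[OF j2(2)] False by simp
    qed
  qed
  then have "xs \<in> alt_perms"
    using perm by (simp add: alt_perms_def alternating_def)
  moreover have "levels xs = F"
    using level_levels[OF len sS] tk LF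
    by (intro list_eq_if_level_eq) (simp_all add: levels_def)
  ultimately show ?thesis
    by blast
qed

lemma card_homology_facets: "card {F \<in> facets. asc F = {}} = card alt_perms"
proof -
  have "levels ` alt_perms = {F \<in> facets. asc F = {}}"
    using levels_alt_perms levels_surj by fast
  then show ?thesis
    using card_image[OF inj_levels] by simp
qed

text \<open>All but the last vertex form a facet whose top has \<open>card S - 2\<close> elements; a
  further vertex strictly between it and \<open>S\<close> would have odd cardinality.\<close>

lemma no_larger_simplices: "ord_simplices (Pposet S B) (Suc (Suc m)) = {}"
proof (rule ccontr)
  assume "ord_simplices (Pposet S B) (Suc (Suc m)) \<noteq> {}"
  then obtain F where F: "F \<in> ord_simplices (Pposet S B) (Suc (Suc m))"
    by blast
  note D = ord_simplicesD[OF F]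
  have "butlast F \<in> facets"
    using D by (auto simp: ord_simplices_def sorted_wrt_iff_nth_less nth_butlast dest: in_set_butlastD)
  from facet_level_card[OF this, of "Suc m"] have "card (F ! m) = 2 * Suc m"
    using D(1) by (simp add: level_def nth_append nth_butlast)
  moreover have sub: "F ! m \<subset> F ! Suc m"
    using sorted_wrt_nth_less[OF D(4), of m "Suc m"] D(1) by simp
  moreover have P: "F ! Suc m \<in> Phat S B" "F ! Suc m \<subset> S"
  proof -
    have "F ! Suc m \<in> Pposet S B"
      using D(1,3) nth_mem[of "Suc m" F] by auto
    then show "F ! Suc m \<in> Phat S B" "F ! Suc m \<subset> S"
      using Phat_subset[of "F ! Suc m"] by (auto simp: Pposet_def)
  qed
  moreover have "card (F ! m) < card (F ! Suc m)" "card (F ! Suc m) < card S"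
    using psubset_card_mono[OF Phat_finite[OF P(1)] sub] psubset_card_mono[OF finite_S P(2)] .
  ultimately show False
    using card_S even_card_Phat[OF P(1)] by presburger
qed

text \<open>Without simplices one dimension higher, the boundaries form the zero space, and the
  Betti number is the dimension of the top cycles.\<close>

lemma reduced_betti_Pposet: "reduced_betti (Pposet S B) m = card alt_perms"
proof -
  have "chains (Pposet S B) (Suc (Suc m)) = {\<lambda>_. 0}"
    using no_larger_simplices by (auto simp: chains_def)
  moreover have "bdry (Pposet S B) (Suc (Suc m)) (\<lambda>_. 0) = (\<lambda>_. 0)"
    by (auto simp: bdry_def fun_eq_iff intro!: sum.neutral)
  moreover have "qdim {(\<lambda>_. 0) :: nat set list \<Rightarrow> rat} = 0"
    using Q.dim_unique[of "{}" "{\<lambda>_. 0}" 0] Q.span_zero[of "{}"] by (simp add: zero_fun_def Q.independent_empty)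
  ultimately show ?thesis
    using shelling.qdim_top_cycles[OF shelling_Pposet] card_homology_facets
    by (simp add: reduced_betti_def)
qed

end

theorem theorem4p4:
  fixes S :: "nat set" and B :: "nat set set" and k :: nat
  assumes "building_set S B"
    and "chordal B"
    and "card S = 2 * k"
    and "k \<ge> 2"
    and "\<forall>C\<in>components B. even (card C)"
  shows "reduced_betti (Pposet S B) (k - 2) =
         card {xs. B_permutation S B xs \<and> alternating xs}"
proof -
  obtain m where k: "k = Suc (Suc m)"
    using assms(4) by (metis One_nat_def Suc_1 Suc_le_D Suc_le_mono)
  \<comment> \<open>Through this equation the parity hypothesis on the components of
    \<open>B\<close> says that \<open>S\<close> belongs to \<open>Phat S B\<close>.\<close>
  have "restr B S = B"
    using assms(1) by (auto simp: restr_def building_set_def)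
  then interpret even_chordal_building S B m
    using assms k by unfold_locales (auto simp: Phat_def)
  show ?thesis
    using reduced_betti_Pposet by (simp add: alt_perms_def k)
qed

end
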